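(* There exists an absolute constant $C>0$ such that for all positive integers $m<n$, $$d_n^m \le C\,\frac{n\ln(m+1)}{\ln\frac{n}{m}}\left(\ln\ln\left(\frac{n}{m}\right)^m\right)^2 .$$
   Context: Let $\mathcal{E}=\{e_1,\dots,e_n\}$ be the standard basis of $\mathbb{Z}^n$. For a lattice $\Lambda$ with $\mathbb{Z}^n\subseteq\Lambda\subset\mathbb{Q}^n$, the defect $d(\mathcal{E},\Lambda)$ is the smallest integer $d$ such that some $n-d$ vectors of $\mathcal{E}$ together with some $d$ vectors of $\Lambda$ form a basis of $\Lambda$. The unit octahedron is $O^n=\{x\in\mathbb{R}^n: |x_1|+\dots+|x_n|\le 1\}$; it is called admissible with respect to $\Lambda$ if $O^n\cap\Lambda=\{0,\pm e_1,\dots,\pm e_n\}$ (equivalently, every $x\in\Lambda\setminus\mathbb{Z}^n$ has $\|x\|_1>1$). Let $\mathcal{A}_m$ be the set of all lattices of the form $\Lambda=\langle \mathbb{Z}^n,a_1,\dots,a_m\rangle_{\mathbb{Z}}$ with $a_1,\dots,a_m\in\mathbb{Q}^n$, and define $d_n^m=\max d(\mathcal{E},\Lambda)$, the maximum taken over all $\Lambda\in\mathcal{A}_m$ with respect to which $O^n$ is admissible. $\ln$ is the natural logarithm.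
   Formalization: The case n = m+1 is excluded (n ≥ m+2 is assumed): there the right side is only of order ln m, while lattices built from shortened Hamming codes have defect at least n − log₂(n+1) − 1, so the stated bound fails for large m. *)

theory Defs
  imports Complex_Main "Jordan_Normal_Form.Matrix"
begin

text \<open>The dimension \<open>n\<close> has to be quantified inside the statement (below the absolute constant), so
  vectors of real \<open>n\<close>-space are elements of \<^term>\<open>carrier_vec n :: real vec set\<close>. The standard
  basis is \<^term>\<open>unit_vecs n\<close>.\<close>

definition rational_vecs :: "nat \<Rightarrow> real vec set" where
  "rational_vecs n = {x \<in> carrier_vec n. \<forall>i<n. x $ i \<in> \<rat>}"

definition int_comb :: "nat \<Rightarrow> real vec list \<Rightarrow> int vec \<Rightarrow> real vec" where
  "int_comb n bs c = mat_of_cols n bs *\<^sub>v map_vec of_int c"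

definition int_span :: "nat \<Rightarrow> real vec list \<Rightarrow> real vec set" where
  "int_span n bs = int_comb n bs ` carrier_vec (length bs)"

text \<open>A basis of a lattice as a free abelian group: a generating list whose integer combinations
  are pairwise different.\<close>

definition is_lattice_basis :: "nat \<Rightarrow> real vec list \<Rightarrow> real vec set \<Rightarrow> bool" where
  "is_lattice_basis n bs L \<longleftrightarrow>
     set bs \<subseteq> carrier_vec n \<and> int_span n bs = L \<and> inj_on (int_comb n bs) (carrier_vec (length bs))"

text \<open>\<open>length es + d = n\<close> says that \<open>es\<close> lists \<open>n - d\<close> of the standard basis vectors, without
  truncated subtraction.\<close>

definition defect :: "nat \<Rightarrow> real vec set \<Rightarrow> nat" where
  "defect n L = (LEAST d. \<exists>es vs.
     distinct es \<and> set es \<subseteq> set (unit_vecs n) \<and> length es + d = n \<and>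
     set vs \<subseteq> L \<and> length vs = d \<and>
     is_lattice_basis n (es @ vs) L)"

definition unit_octahedron :: "nat \<Rightarrow> real vec set" where
  "unit_octahedron n = {x \<in> carrier_vec n. (\<Sum>i<n. \<bar>x $ i\<bar>) \<le> 1}"

definition octahedron_admissible :: "nat \<Rightarrow> real vec set \<Rightarrow> bool" where
  "octahedron_admissible n L \<longleftrightarrow>
     unit_octahedron n \<inter> L = {0\<^sub>v n} \<union> set (unit_vecs n) \<union> uminus ` set (unit_vecs n)"

text \<open>The lattices generated by the integer vectors and \<open>m\<close> rational vectors, which need not be
  distinct or nonzero.\<close>

definition lattice_class :: "nat \<Rightarrow> nat \<Rightarrow> real vec set set" where
  "lattice_class n m =
     {int_span n (unit_vecs n @ gs) | gs. length gs = m \<and> set gs \<subseteq> rational_vecs n}"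

definition max_defect :: "nat \<Rightarrow> nat \<Rightarrow> nat" where
  "max_defect n m = Max (defect n ` {L \<in> lattice_class n m. octahedron_admissible n L})"

text \<open>A bound on \<^term>\<open>max_defect n m\<close> by a constant times
  \<open>n ln(m+1) / ln(n/m) (ln ln (n/m)^m)^2\<close> degenerates for \<open>n = m + 1\<close>: there \<open>(n/m)^m\<close> tends to
  \<open>e\<close>, so \<open>ln ln (n/m)^m\<close> is asymptotic to \<open>-1/(2m)\<close> and the expression is only of order \<open>ln m\<close>.
  However, if \<open>C\<close> is a binary linear code of length \<open>n\<close>, minimum distance at least 3 and dimension
  \<open>k\<close> (a shortened Hamming code has \<open>k \<ge> n - log2(n+1) - 1\<close>), then the octahedron is
  admissible for the lattice of all \<open>x\<close> such that \<open>2x\<close> is an integer vector reducing modulo 2 into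
  \<open>C\<close>, and this lattice has defect at least \<open>k\<close>. Hence the bound is meant for \<open>n \<ge> m + 2\<close>, where
  \<open>(n/m)^m \<ge> 3\<close>.\<close>

end

theory Submission
  imports Defs "HOL-Library.Function_Algebras" "HOL-Library.FuncSet" "HOL-Computational_Algebra.Primes"
begin

text \<open>The group \<open>G = L / Z^n\<close> is a finite subgroup of \<open>(R / Z)^n\<close>, and the defect is at most the size of any
  set \<open>T\<close> of coordinates such that the restriction of \<open>G\<close> to \<open>T\<close> is injective. It suffices that the
  restriction is injective on the \<open>p\<close>-torsion \<open>G[p]\<close>, which has rank at most \<open>m\<close>, for each prime \<open>p\<close>.
  By Dirichlet's theorem on simultaneous approximation, admissibility forces every subgroup \<open>V\<close> of
  \<open>G\<close> with support of size \<open>W\<close> to satisfy \<open>card V \<le> W ^ W\<close>. Hence a subgroup of \<open>G[p]\<close> of rank \<open>k\<close> has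
  support of size at least \<open>k w\<close>, where \<open>w\<close> is about \<open>ln p / ln (m ln p)\<close>, and a random coordinate
  decreases the sum of the ranks over all large \<open>p\<close> by a factor of \<open>1 - w / n\<close> on average. After
  \<open>(n / w) ln (m ln n)\<close> greedy choices that sum is small; the remaining rank, and the rank at the
  small primes, is removed one coordinate at a time.\<close>

section \<open>The circle group\<close>

\<comment> \<open>R/Z is made a type so that, with the pointwise operations of function algebras,
  \<open>nat \<Rightarrow> circle\<close> is an abelian group.\<close>
quotient_type circle = real / "\<lambda>x y. x - y \<in> \<int>"
  morphisms rep_circle to_circle
proof (intro equivpI reflpI sympI transpI)
  show "x - x \<in> \<int>" for x :: real by simp
  show "y - x \<in> \<int>" if "x - y \<in> \<int>" for x y :: real
    using that Ints_minus[of "x - y"] by simp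
  show "x - z \<in> \<int>" if "x - y \<in> \<int>" "y - z \<in> \<int>" for x y z :: real
    using Ints_add[OF that] by simp
qed

instantiation circle :: ab_group_add
begin

lift_definition zero_circle :: circle is 0 .

lift_definition plus_circle :: "circle \<Rightarrow> circle \<Rightarrow> circle" is "(+)"
proof -
  fix x x' y y' :: real
  assume "x - x' \<in> \<int>" "y - y' \<in> \<int>"
  then have "(x - x') + (y - y') \<in> \<int>" by (rule Ints_add)
  then show "(x + y) - (x' + y') \<in> \<int>" by (simp add: add_diff_add)
qed

lift_definition uminus_circle :: "circle \<Rightarrow> circle" is uminus
proof -
  fix x y :: real
  assume "x - y \<in> \<int>"
  then have "- (x - y) \<in> \<int>" by (rule Ints_minus)
  then show "- x - - y \<in> \<int>" by simp
qed

lift_definition minus_circle :: "circle \<Rightarrow> circle \<Rightarrow> circle" is "(-)"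
proof -
  fix x x' y y' :: real
  assume "x - x' \<in> \<int>" "y - y' \<in> \<int>"
  then have "(x - x') - (y - y') \<in> \<int>" by (rule Ints_diff)
  then show "(x - y) - (x' - y') \<in> \<int>" by (simp add: algebra_simps)
qed

instance
  by standard (transfer; simp add: algebra_simps)+

end

lift_definition cscale :: "int \<Rightarrow> circle \<Rightarrow> circle" is "\<lambda>k x. of_int k * x"
proof -
  fix k :: int and x y :: real
  assume "x - y \<in> \<int>"
  then have "of_int k * (x - y) \<in> \<int>" by (rule Ints_mult[OF Ints_of_int])
  then show "of_int k * x - of_int k * y \<in> \<int>" by (simp add: right_diff_distrib)
qed

lift_definition cfrac :: "circle \<Rightarrow> real" is frac
proof -
  fix x y :: real
  assume "x - y \<in> \<int>"
  then have "frac (y + (x - y)) = frac y" by (rule frac_add_int_right)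
  then show "frac x = frac y" by simp
qed

lemma to_circle_add: "to_circle (x + y) = to_circle x + to_circle y"
  by (simp add: plus_circle.abs_eq)

lemma to_circle_diff: "to_circle (x - y) = to_circle x - to_circle y"
  by (simp add: minus_circle.abs_eq)

lemma to_circle_eq_0_iff: "to_circle x = 0 \<longleftrightarrow> x \<in> \<int>"
  by transfer simp

lemma to_circle_0 [simp]: "to_circle 0 = 0"
  by (simp add: to_circle_eq_0_iff)

lemma cscale_to_circle: "cscale k (to_circle x) = to_circle (of_int k * x)"
  by (simp add: cscale.abs_eq)

lemma to_circle_cfrac [simp]: "to_circle (cfrac z) = z"
  by transfer (simp add: frac_def)

lemma cfrac_ge_0: "0 \<le> cfrac z" and cfrac_less_1: "cfrac z < 1"
  by (transfer, simp add: frac_lt_1)+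

lemma cscale_0_left [simp]: "cscale 0 z = 0"
  by transfer simp

lemma cscale_0_right [simp]: "cscale k 0 = 0"
  by transfer simp

lemma cscale_1 [simp]: "cscale 1 z = z"
  by transfer simp

lemma cscale_add_left: "cscale (k + l) z = cscale k z + cscale l z"
  by transfer (simp add: algebra_simps)

lemma cscale_diff_left: "cscale (k - l) z = cscale k z - cscale l z"
  by transfer (simp add: algebra_simps)

lemma cscale_diff_right: "cscale k (y - z) = cscale k y - cscale k z"
  by transfer (simp add: algebra_simps)

lemma cscale_cscale: "cscale k (cscale l z) = cscale (k * l) z"
  by transfer (simp add: algebra_simps)

text \<open>By Bezout, \<open>z\<close> is an integer combination of \<open>cscale k z\<close> and
  \<open>cscale l z\<close>.\<close>

lemma cscale_eq_0_coprime:
  assumes "cscale k z = 0" "cscale l z = 0" "coprime k l"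
  shows "z = 0"
proof -
  obtain u v where uv: "u * k + v * l = 1"
    using assms(3) bezout_int[of k l] by auto
  have "z = cscale (u * k + v * l) z" using uv by simp
  also have "\<dots> = cscale u (cscale k z) + cscale v (cscale l z)"
    by (simp add: cscale_add_left cscale_cscale)
  finally show ?thesis using assms by simp
qed

section \<open>Finite subgroups and their images under a coordinate\<close>

definition add_subgroup :: "'a::ab_group_add set \<Rightarrow> bool" where
  "add_subgroup H \<longleftrightarrow> 0 \<in> H \<and> (\<forall>x\<in>H. \<forall>y\<in>H. x - y \<in> H)"

lemma add_subgroup_0: "add_subgroup H \<Longrightarrow> 0 \<in> H"
  and add_subgroup_diff: "add_subgroup H \<Longrightarrow> x \<in> H \<Longrightarrow> y \<in> H \<Longrightarrow> x - y \<in> H"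
  by (auto simp: add_subgroup_def)

lemma add_subgroup_add:
  assumes "add_subgroup H" "x \<in> H" "y \<in> H"
  shows "x + y \<in> H"
proof -
  have "x - (0 - y) \<in> H" using assms by (intro add_subgroup_diff add_subgroup_0)
  then show ?thesis by simp
qed

text \<open>The first isomorphism theorem in counted form: each fibre over the image is a translate
  of the kernel.\<close>

lemma card_kernel_times_image:
  fixes f :: "'a::ab_group_add \<Rightarrow> 'b::ab_group_add"
  assumes fin: "finite V" and V: "add_subgroup V"
    and f: "\<And>x y. x \<in> V \<Longrightarrow> y \<in> V \<Longrightarrow> f (x - y) = f x - f y"
  shows "card V = card {x \<in> V. f x = 0} * card (f ` V)"
proof -
  have fibre: "card {x \<in> V. f x = y} = card {x \<in> V. f x = 0}" if "y \<in> f ` V" for y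
  proof -
    obtain v where v: "v \<in> V" "f v = y" using \<open>y \<in> f ` V\<close> by auto
    have f_add: "f (x + v) = y" if x: "x \<in> V" "f x = 0" for x
    proof -
      have "f (x + v) - f v = f (x + v - v)" using f[OF add_subgroup_add[OF V x(1) v(1)] v(1)] by simp
      then show ?thesis using x v by simp
    qed
    have "bij_betw (\<lambda>x. x - v) {x \<in> V. f x = y} {x \<in> V. f x = 0}"
    proof (rule bij_betw_byWitness[where f' = "\<lambda>x. x + v"])
      show "(\<lambda>x. x - v) ` {x \<in> V. f x = y} \<subseteq> {x \<in> V. f x = 0}"
      proof (intro image_subsetI CollectI conjI)
        fix x assume x: "x \<in> {x \<in> V. f x = y}"
        show "x - v \<in> V" using x v V by (simp add: add_subgroup_diff)
        have "f (x - v) = f x - f v" using x v by (intro f) simp_all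
        then show "f (x - v) = 0" using x v by simp
      qed
      show "(\<lambda>x. x + v) ` {x \<in> V. f x = 0} \<subseteq> {x \<in> V. f x = y}"
        using f_add v V by (intro image_subsetI) (simp add: add_subgroup_add)
    qed simp_all
    then show ?thesis by (rule bij_betw_same_card)
  qed
  have "card V = (\<Sum>y\<in>f ` V. card {x \<in> V. f x = y})"
    using sum.image_gen[OF fin, of "\<lambda>_. 1::nat" f] by simp
  also have "\<dots> = (\<Sum>y\<in>f ` V. card {x \<in> V. f x = 0})" using fibre by (intro sum.cong) auto
  finally show ?thesis by simp
qed

lemma cscale_mem_subgroup:
  assumes H: "add_subgroup H" and g: "g \<in> H"
  shows "(\<lambda>i. cscale k (g i)) \<in> H"
proof (induction k rule: int_induct[where k = 0])
  case base
  have "(\<lambda>i. cscale 0 (g i)) = 0" by (simp add: fun_eq_iff)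
  then show ?case using add_subgroup_0[OF H] by simp
next
  case (step1 k)
  have "(\<lambda>i. cscale (k + 1) (g i)) = (\<lambda>i. cscale k (g i)) + g"
    by (simp add: fun_eq_iff cscale_add_left)
  then show ?case using add_subgroup_add[OF H step1(2) g] by simp
next
  case (step2 k)
  have "(\<lambda>i. cscale (k - 1) (g i)) = (\<lambda>i. cscale k (g i)) - g"
    by (simp add: fun_eq_iff cscale_diff_left)
  then show ?case using add_subgroup_diff[OF H step2(2) g] by simp
qed

text \<open>The representative of \<open>z\<close> in [0, 1) times \<open>q\<close> is an integer
  \<open>b\<close> with 0 \<le> b < q, so \<open>z\<close> is the class of b/q.\<close>

lemma torsion_circle_subset:
  assumes q: "q > 0" and z: "cscale (int q) z = 0"
  shows "z \<in> (\<lambda>k. to_circle (real k / real q)) ` {..<q}"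
proof -
  have "to_circle (real q * cfrac z) = cscale (int q) z"
    using cscale_to_circle[of "int q" "cfrac z"] by simp
  then obtain b where b: "real q * cfrac z = of_int b"
    using z by (auto simp: to_circle_eq_0_iff elim: Ints_cases)
  have "0 \<le> real q * cfrac z" by (simp add: cfrac_ge_0)
  moreover have "real q * cfrac z < real q * 1" using q cfrac_less_1 by (intro mult_strict_left_mono) auto
  ultimately have b0: "0 \<le> b" "b < int q" using b by simp_all
  have "cfrac z = of_int b / real q" using b q by (simp add: field_simps)
  then have "z = to_circle (real (nat b) / real q)"
    using to_circle_cfrac[of z] b0 by (metis of_int_of_nat_eq int_nat_eq)
  then show ?thesis using b0 by (intro image_eqI[of _ _ "nat b"]) auto
qed

text \<open>The image lies in the p-torsion of the circle, which has at most \<open>p\<close>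
  elements; it contains the multiples of \<open>g i\<close> by 0, ..., p - 1, which are distinct
  because \<open>p\<close> is prime.\<close>

lemma card_image_coordinate:
  fixes V :: "('i \<Rightarrow> circle) set"
  assumes p: "prime (p::nat)" and V: "add_subgroup V"
    and tors: "\<And>g. g \<in> V \<Longrightarrow> cscale (int p) (g i) = 0"
    and g: "g \<in> V" "g i \<noteq> 0"
  shows "card ((\<lambda>g. g i) ` V) = p"
proof -
  let ?H = "(\<lambda>g. g i) ` V" and ?C = "(\<lambda>k. to_circle (real k / real p)) ` {..<p}"
  have sub: "?H \<subseteq> ?C"
    using tors torsion_circle_subset p prime_gt_0_nat by blast
  have "card ?H \<le> card ?C" using sub by (intro card_mono) auto
  also have "\<dots> \<le> p" using card_image_le[of "{..<p}"] by simp
  finally have le: "card ?H \<le> p" .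
  have "inj_on (\<lambda>k. cscale (int k) (g i)) {..<p}"
  proof (rule linorder_inj_onI)
    fix k l :: nat assume kl: "k < l" "k \<in> {..<p}" "l \<in> {..<p}"
    have "\<not> p dvd (l - k)" using kl by (auto dest: dvd_imp_le)
    then have "coprime (int p) (int (l - k))" using p prime_imp_coprime coprime_int_iff by blast
    then have "coprime (int p) (int l - int k)" using kl by (simp add: of_nat_diff)
    then have "cscale (int l - int k) (g i) \<noteq> 0"
      using cscale_eq_0_coprime tors g by blast
    then show "cscale (int k) (g i) \<noteq> cscale (int l) (g i)" by (simp add: cscale_diff_left)
  qed auto
  moreover have "(\<lambda>k. cscale (int k) (g i)) ` {..<p} \<subseteq> ?H"
  proof (rule image_subsetI)
    fix k show "cscale (int k) (g i) \<in> ?H"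
      using cscale_mem_subgroup[OF V g(1), of "int k"] by (intro image_eqI) auto
  qed
  moreover have "finite ?H" using sub by (rule finite_subset) simp
  ultimately have "p \<le> card ?H" using card_inj_on_le by fastforce
  with le show ?thesis by simp
qed

section \<open>Group codes without short vectors\<close>

text \<open>Models L / Z^n by functions that vanish from index \<open>n\<close> on.
  \<open>admissible\<close> speaks of every real lift with a nonintegral entry, and
  \<open>card_torsion_le\<close> says that G[p] has rank at most \<open>m\<close>.\<close>

locale octahedral_code =
  fixes n m :: nat and G :: "(nat \<Rightarrow> circle) set"
  assumes finite_G: "finite G" and subgroup_G: "add_subgroup G"
    and support_G: "\<And>g i. g \<in> G \<Longrightarrow> n \<le> i \<Longrightarrow> g i = 0"
    and admissible: "\<And>x i. (\<lambda>i. to_circle (x i)) \<in> G \<Longrightarrow> x i \<notin> \<int> \<Longrightarrow> 1 < (\<Sum>i<n. \<bar>x i :: real\<bar>)"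
    and card_torsion_le: "\<And>p. prime p \<Longrightarrow> card {g \<in> G. \<forall>i. cscale (int p) (g i) = 0} \<le> p ^ m"
begin

text \<open>Dirichlet's pigeonhole argument: with N = card A, cut the circle at each coordinate of
  \<open>A\<close> into N arcs of length 1/N. Among more than N^N elements two share a box, and
  their difference has a nonintegral lift of norm at most N * (1/N) = 1, against
  admissibility.\<close>

lemma card_subgroup_le_support_power:
  assumes V: "V \<subseteq> G" "add_subgroup V" and A: "A \<subseteq> {..<n}" "\<And>g i. g \<in> V \<Longrightarrow> i \<notin> A \<Longrightarrow> g i = 0"
  shows "card V \<le> card A ^ card A"
proof (rule ccontr)
  assume "\<not> ?thesis"
  then have less: "card A ^ card A < card V" by simp
  have fin: "finite A" using A(1) finite_subset by blast
  define N where "N = card A"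
  \<comment> \<open>For empty \<open>A\<close> the group is trivial and the bound
    \<open>0 ^ 0\<close> equals 1, so this case cannot violate it and \<open>N\<close> is
    positive.\<close>
  have "A \<noteq> {}"
  proof
    assume "A = {}"
    then have "V \<subseteq> {0}" using A(2) by (auto simp: fun_eq_iff)
    then have "card V \<le> 1" using card_mono[of "{0}" V] by simp
    then show False using less \<open>A = {}\<close> by simp
  qed
  then have N: "N > 0" using fin by (simp add: N_def card_gt_0_iff)
  define box where "box g = (\<lambda>i\<in>A. nat \<lfloor>real N * cfrac (g i)\<rfloor>)" for g :: "nat \<Rightarrow> circle"
  have "box ` V \<subseteq> A \<rightarrow>\<^sub>E {..<N}"
  proof (intro image_subsetI)
    fix g :: "nat \<Rightarrow> circle"
    have "nat \<lfloor>real N * cfrac (g i)\<rfloor> < N" for i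
    proof -
      have "real N * cfrac (g i) < real N * 1" using N cfrac_less_1 by (intro mult_strict_left_mono) auto
      then have "\<lfloor>real N * cfrac (g i)\<rfloor> < int N" by (simp add: floor_less_iff)
      then show ?thesis using N by linarith
    qed
    then show "box g \<in> A \<rightarrow>\<^sub>E {..<N}" by (auto simp: box_def)
  qed
  then have "card (box ` V) \<le> card (A \<rightarrow>\<^sub>E {..<N})"
    using fin by (intro card_mono) (auto intro: finite_PiE)
  also have "\<dots> = N ^ N" using fin by (simp add: card_PiE N_def)
  finally have "\<not> inj_on box V" using less by (intro pigeonhole) (simp add: N_def)
  then obtain g h where gh: "g \<in> V" "h \<in> V" "g \<noteq> h" "box g = box h" by (auto simp: inj_on_def)
  \<comment> \<open>Using the representatives in [0, 1) makes this lift of \<open>g - h\<close>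
    vanish outside \<open>A\<close> and stay small on \<open>A\<close>.\<close>
  define x where "x i = cfrac (g i) - cfrac (h i)" for i
  have x: "(\<lambda>i. to_circle (x i)) = g - h" by (simp add: x_def to_circle_diff fun_eq_iff)
  obtain j where "g j \<noteq> h j" using gh(3) by auto
  then have "to_circle (x j) \<noteq> 0" by (simp add: x_def to_circle_diff)
  then have "x j \<notin> \<int>" by (simp add: to_circle_eq_0_iff)
  moreover have "(\<lambda>i. to_circle (x i)) \<in> G"
    unfolding x using V gh add_subgroup_diff by blast
  ultimately have "1 < (\<Sum>i<n. \<bar>x i\<bar>)" using admissible by blast
  also have "\<dots> = (\<Sum>i\<in>A. \<bar>x i\<bar>)"
  proof -
    have "x i = 0" if "i \<notin> A" for i using A(2)[OF gh(1) that] A(2)[OF gh(2) that] by (simp add: x_def)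
    then show ?thesis using A(1) by (intro sum.mono_neutral_right) auto
  qed
  also have "\<dots> \<le> (\<Sum>i\<in>A. 1 / real N)"
  proof (rule sum_mono)
    fix i assume "i \<in> A"
    then have "nat \<lfloor>real N * cfrac (g i)\<rfloor> = nat \<lfloor>real N * cfrac (h i)\<rfloor>"
      using fun_cong[OF gh(4), of i] by (simp add: box_def)
    moreover have "0 \<le> real N * cfrac (g i)" "0 \<le> real N * cfrac (h i)" by (simp_all add: cfrac_ge_0)
    ultimately have "\<lfloor>real N * cfrac (g i)\<rfloor> = \<lfloor>real N * cfrac (h i)\<rfloor>" by linarith
    then have "\<bar>real N * cfrac (g i) - real N * cfrac (h i)\<bar> \<le> 1" by linarith
    then have "real N * \<bar>x i\<bar> \<le> 1"
      using N by (simp add: x_def abs_mult flip: right_diff_distrib)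
    then show "\<bar>x i\<bar> \<le> 1 / real N" using N by (simp add: field_simps)
  qed
  also have "\<dots> = 1" using N by (simp add: N_def)
  finally show False by simp
qed

section \<open>Ranks of the torsion subgroups\<close>

definition tor :: "nat \<Rightarrow> nat set \<Rightarrow> (nat \<Rightarrow> circle) set" where
  "tor p T = {g \<in> G. (\<forall>i. cscale (int p) (g i) = 0) \<and> (\<forall>i\<in>T. g i = 0)}"

text \<open>For prime \<open>p\<close>, these are the coordinates whose insertion into
  \<open>T\<close> makes \<open>tor p T\<close> smaller.\<close>

definition tor_support :: "nat \<Rightarrow> nat set \<Rightarrow> nat set" where
  "tor_support p T = {i. \<exists>g\<in>tor p T. g i \<noteq> 0}"

text \<open>For prime \<open>p\<close>, this is the dimension of \<open>tor p T\<close> over the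
  field with \<open>p\<close> elements, written as a logarithm so that no vector space structure has
  to be set up.\<close>

definition rk :: "nat \<Rightarrow> nat set \<Rightarrow> real" where
  "rk p T = log (real p) (real (card (tor p T)))"

lemma finite_tor: "finite (tor p T)"
  using finite_G by (simp add: tor_def)

lemma subgroup_tor: "add_subgroup (tor p T)"
  using subgroup_G by (auto simp: tor_def add_subgroup_def cscale_diff_right)

lemma card_tor_pos: "card (tor p T) > 0"
  using finite_tor add_subgroup_0[OF subgroup_tor, of p T] by (auto simp: card_gt_0_iff)

lemma tor_support_subset: "tor_support p T \<subseteq> {..<n} - T"
  using support_G by (force simp: tor_support_def tor_def not_le)

lemma tor_antimono: "T \<subseteq> T' \<Longrightarrow> tor p T' \<subseteq> tor p T"
  by (auto simp: tor_def)

lemma tor_support_empty: "tor_support p T = {} \<longleftrightarrow> card (tor p T) = 1"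
proof
  assume "tor_support p T = {}"
  then have "tor p T = {0}" using add_subgroup_0[OF subgroup_tor, of p T]
    by (auto simp: tor_support_def fun_eq_iff)
  then show "card (tor p T) = 1" by simp
next
  assume "card (tor p T) = 1"
  then have "tor p T = {0}" using add_subgroup_0[OF subgroup_tor, of p T]
    by (auto simp: card_1_singleton_iff)
  then show "tor_support p T = {}" by (auto simp: tor_support_def)
qed

text \<open>Evaluation at \<open>i\<close> maps \<open>tor p T\<close> onto a group of order
  \<open>p\<close>, with kernel \<open>tor p (insert i T)\<close>.\<close>

lemma card_tor_insert:
  assumes "prime p" "i \<in> tor_support p T"
  shows "card (tor p T) = card (tor p (insert i T)) * p"
proof -
  have "{g \<in> tor p T. g i = 0} = tor p (insert i T)" by (auto simp: tor_def)
  moreover have "card ((\<lambda>g. g i) ` tor p T) = p"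
    using assms subgroup_tor
    by (auto simp: tor_support_def tor_def intro!: card_image_coordinate)
  ultimately show ?thesis
    using card_kernel_times_image[OF finite_tor[of p T] subgroup_tor, of "\<lambda>g. g i"] by simp
qed

lemma rk_nonneg: "prime p \<Longrightarrow> 0 \<le> rk p T"
  using card_tor_pos[of p T] prime_gt_1_nat[of p] by (simp add: rk_def)

lemma rk_antimono: "prime p \<Longrightarrow> T \<subseteq> T' \<Longrightarrow> rk p T' \<le> rk p T"
  using card_tor_pos[of p T'] card_mono[OF finite_tor tor_antimono, of T T' p]
    prime_gt_1_nat[of p]
  by (simp add: rk_def)

lemma rk_insert:
  assumes "prime p" "i \<in> tor_support p T"
  shows "rk p (insert i T) = rk p T - 1"
proof -
  have "real p > 1" using assms(1) prime_gt_1_nat by simp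
  then show ?thesis
    using card_tor_insert[OF assms] card_tor_pos[of p "insert i T"]
    by (simp add: rk_def log_mult)
qed

lemma rk_eq_0_iff: "prime p \<Longrightarrow> rk p T = 0 \<longleftrightarrow> tor_support p T = {}"
  using card_tor_pos[of p T] prime_gt_1_nat[of p]
  by (simp add: rk_def tor_support_empty log_def)

lemma rk_le: 
  assumes "prime p" shows "rk p T \<le> m"
proof -
  have "card (tor p T) \<le> card {g \<in> G. \<forall>i. cscale (int p) (g i) = 0}"
    using finite_G by (intro card_mono) (auto simp: tor_def)
  also have "\<dots> \<le> p ^ m" using card_torsion_le assms by blast
  finally have "real (card (tor p T)) \<le> real p ^ m" by (metis of_nat_le_iff of_nat_power)
  moreover have "real p > 1" using assms prime_gt_1_nat by simp
  ultimately show ?thesis using card_tor_pos[of p T]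
    by (simp add: rk_def Transcendental.log_le_iff powr_realpow)
qed

text \<open>Dirichlet's theorem applied to \<open>tor p T\<close> gives \<open>W ln W \<ge> rk p T * ln p\<close> for the size \<open>W\<close> of
  its support.\<close>

lemma rk_le_card_support:
  assumes p: "prime p" and w: "w > 0" "w * ln (real m * w) \<le> ln (real p)"
  shows "w * rk p T \<le> card (tor_support p T)"
proof (rule ccontr)
  assume neg: "\<not> ?thesis"
  define k where "k = rk p T"
  define W where "W = card (tor_support p T)"
  have W: "real W < w * k" using neg by (simp add: W_def k_def)
  have k: "k \<ge> 0" "k \<le> m" using rk_nonneg rk_le p by (auto simp: k_def)
  have "k > 0" using W k(1) w(1) by (cases "k = 0") auto
  have lnp: "ln (real p) > 0" using prime_gt_1_nat[OF p] by simp
  have "finite (tor_support p T)" using tor_support_subset finite_subset by blast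
  then have W0: "W > 0" using \<open>k > 0\<close> rk_eq_0_iff[OF p, of T] by (auto simp: W_def k_def card_gt_0_iff)
  have "card (tor p T) \<le> W ^ W"
    unfolding W_def using tor_support_subset subgroup_tor
    by (intro card_subgroup_le_support_power) (auto simp: tor_support_def tor_def)
  then have "ln (real (card (tor p T))) \<le> ln (real (W ^ W))"
    using card_tor_pos[of p T] W0 by (subst ln_le_cancel_iff) (auto simp flip: of_nat_power)
  then have "k * ln (real p) \<le> real W * ln (real W)"
    using lnp W0 by (simp add: k_def rk_def log_def ln_realpow)
  \<comment> \<open>A support smaller than w k also has W < m w, since k \<le> m; this removes the
    unknown W from the logarithm.\<close>
  also have "\<dots> \<le> real W * ln (real m * w)"
  proof -
    have "w * k \<le> real m * w" using k(2) w(1) by (simp add: mult.commute)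
    then show ?thesis using W W0 by (intro mult_left_mono) auto
  qed
  finally have *: "k * ln (real p) \<le> real W * ln (real m * w)" .
  \<comment> \<open>The sign of ln (m w) is not assumed: it is positive because W ln (m w) is at
    least k ln p.\<close>
  have "k * ln (real p) > 0" using \<open>k > 0\<close> lnp by simp
  then have "real W * ln (real m * w) > 0" using * by linarith
  then have "ln (real m * w) > 0" using W0 by (simp add: zero_less_mult_iff)
  then have "real W * ln (real m * w) < w * k * ln (real m * w)" using W by simp
  also have "\<dots> = k * (w * ln (real m * w))" by simp
  also have "\<dots> \<le> k * ln (real p)" using k w(2) by (intro mult_left_mono) auto
  finally show False using * by simp
qed

section \<open>Greedy choice of coordinates\<close>

text \<open>Averaging over all \<open>n\<close> coordinates: inserting \<open>i\<close> lowers
  \<open>rk p T\<close> by 1 for each \<open>i\<close> in the support, and the support has size at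
  least \<open>w * rk p T\<close>. Hence the mean over \<open>i\<close> of the new rank sum is at
  most (1 - w/n) times the old one.\<close>

lemma rk_sum_step:
  assumes Q: "finite Q" "\<And>p. p \<in> Q \<Longrightarrow> prime p \<and> w * ln (real m * w) \<le> ln (real p)"
    and w: "w > 0" and n: "n > 0"
  shows "\<exists>i<n. (\<Sum>p\<in>Q. rk p (insert i T)) \<le> (1 - w / n) * (\<Sum>p\<in>Q. rk p T)"
proof (rule ccontr)
  assume "\<not> ?thesis"
  then have less: "(1 - w / n) * (\<Sum>p\<in>Q. rk p T) < (\<Sum>p\<in>Q. rk p (insert i T))" if "i < n" for i
    using that by force
  have "n * ((1 - w / n) * (\<Sum>p\<in>Q. rk p T)) = (\<Sum>i<n. (1 - w / n) * (\<Sum>p\<in>Q. rk p T))" by simp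
  also have "\<dots> < (\<Sum>i<n. \<Sum>p\<in>Q. rk p (insert i T))"
    using less n by (intro sum_strict_mono) auto
  also have "\<dots> = (\<Sum>p\<in>Q. \<Sum>i<n. rk p (insert i T))" by (rule sum.swap)
  also have "\<dots> \<le> (\<Sum>p\<in>Q. (n - w) * rk p T)"
  proof (rule sum_mono)
    fix p assume "p \<in> Q"
    then have p: "prime p" "w * ln (real m * w) \<le> ln (real p)" using Q by auto
    have "(\<Sum>i<n. rk p (insert i T)) \<le> (\<Sum>i<n. rk p T - (if i \<in> tor_support p T then 1 else 0))"
      using rk_insert[OF p(1)] rk_antimono[OF p(1) subset_insertI] by (intro sum_mono) auto
    also have "\<dots> = n * rk p T - card ({..<n} \<inter> tor_support p T)"
      by (simp add: sum_subtractf sum.If_cases)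
    also have "{..<n} \<inter> tor_support p T = tor_support p T" using tor_support_subset by blast
    also have "n * rk p T - card (tor_support p T) \<le> (n - w) * rk p T"
      using rk_le_card_support[OF p(1) w p(2)] by (simp add: algebra_simps)
    finally show "(\<Sum>i<n. rk p (insert i T)) \<le> (n - w) * rk p T" .
  qed
  also have "\<dots> = n * ((1 - w / n) * (\<Sum>p\<in>Q. rk p T))"
    using n unfolding sum_distrib_left[symmetric] by (simp add: field_simps)
  finally show False by simp
qed

text \<open>Iterates \<open>rk_sum_step\<close>, using 1 - w/n \<le> exp (- w/n). The size of
  \<open>T\<close> is only bounded by \<open>t\<close>, since a chosen coordinate may lie in
  \<open>T\<close> already.\<close>

lemma rk_sum_greedy:
  assumes Q: "finite Q" "\<And>p. p \<in> Q \<Longrightarrow> prime p \<and> w * ln (real m * w) \<le> ln (real p)"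
    and w: "w > 0" and n: "n > 0"
  shows "\<exists>T\<subseteq>{..<n}. card T \<le> t \<and> (\<Sum>p\<in>Q. rk p T) \<le> exp (- (t * w / n)) * (\<Sum>p\<in>Q. rk p {})"
proof (induction t)
  case 0
  then show ?case by (intro exI[of _ "{}"]) auto
next
  case (Suc t)
  then obtain T where T: "T \<subseteq> {..<n}" "card T \<le> t"
      "(\<Sum>p\<in>Q. rk p T) \<le> exp (- (t * w / n)) * (\<Sum>p\<in>Q. rk p {})" by blast
  obtain i where i: "i < n" "(\<Sum>p\<in>Q. rk p (insert i T)) \<le> (1 - w / n) * (\<Sum>p\<in>Q. rk p T)"
    using rk_sum_step[OF Q w n] by blast
  have nonneg: "0 \<le> (\<Sum>p\<in>Q. rk p T)" using Q(2) rk_nonneg by (intro sum_nonneg) auto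
  have "(\<Sum>p\<in>Q. rk p (insert i T)) \<le> exp (- (w / n)) * (\<Sum>p\<in>Q. rk p T)"
    using i(2) mult_right_mono[OF _ nonneg, of "1 - w / n" "exp (- (w / n))"]
      exp_ge_add_one_self[of "- (w / n)"] by simp
  also have "\<dots> \<le> exp (- (w / n)) * (exp (- (t * w / n)) * (\<Sum>p\<in>Q. rk p {}))"
    using T(3) by (intro mult_left_mono) auto
  also have "\<dots> = exp (- (Suc t * w / n)) * (\<Sum>p\<in>Q. rk p {})"
    by (simp add: exp_add[symmetric] add_divide_distrib algebra_simps)
  finally have "(\<Sum>p\<in>Q. rk p (insert i T)) \<le> exp (- (Suc t * w / n)) * (\<Sum>p\<in>Q. rk p {})" .
  moreover have "card (insert i T) \<le> Suc t" using T(2) card_insert_le_m1[of "Suc t" T i] by simp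
  ultimately show ?case using T(1) i(1) by (intro exI[of _ "insert i T"]) auto
qed

lemma rk_sum_exhaust:
  assumes Q: "finite Q" "\<And>p. p \<in> Q \<Longrightarrow> prime p" and T: "T \<subseteq> {..<n}"
  shows "\<exists>T'\<subseteq>{..<n}. real (card T') \<le> card T + (\<Sum>p\<in>Q. rk p T) \<and> (\<Sum>p\<in>Q. rk p T') = 0"
  using T
proof (induction "card ({..<n} - T)" arbitrary: T rule: less_induct)
  case less
  show ?case
  proof (cases "(\<Sum>p\<in>Q. rk p T) = 0")
    case True
    then show ?thesis using less.prems by (intro exI[of _ T]) auto
  next
    case False
    then obtain p where p: "p \<in> Q" "rk p T \<noteq> 0" by (meson sum.neutral)
    have prime: "prime p" using p Q by auto
    then obtain i where i: "i \<in> tor_support p T" using p(2) rk_eq_0_iff by blast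
    have iT: "i < n" "i \<notin> T" using i tor_support_subset by blast+
    have "card ({..<n} - insert i T) < card ({..<n} - T)"
      using iT by (intro psubset_card_mono) auto
    then obtain T' where T': "T' \<subseteq> {..<n}" "(\<Sum>p\<in>Q. rk p T') = 0"
        "real (card T') \<le> card (insert i T) + (\<Sum>p\<in>Q. rk p (insert i T))"
      using less.hyps[of "insert i T"] less.prems iT by auto
    have "(\<Sum>q\<in>Q. rk q (insert i T)) = rk p (insert i T) + (\<Sum>q\<in>Q - {p}. rk q (insert i T))"
      using Q(1) p(1) by (rule sum.remove)
    also have "\<dots> \<le> (rk p T - 1) + (\<Sum>q\<in>Q - {p}. rk q T)"
      using rk_insert[OF prime i] Q(2) by (intro add_mono sum_mono rk_antimono) auto
    also have "\<dots> = (\<Sum>q\<in>Q. rk q T) - 1"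
      using sum.remove[OF Q(1) p(1), of "\<lambda>q. rk q T"] by simp
    finally have "(\<Sum>q\<in>Q. rk q (insert i T)) \<le> (\<Sum>q\<in>Q. rk q T) - 1" .
    moreover have "real (card (insert i T)) \<le> card T + 1"
      using finite_subset[OF less.prems] iT by simp
    ultimately show ?thesis using T' by (intro exI[of _ T']) auto
  qed
qed

section \<open>From prime torsion to the whole group\<close>

text \<open>Restricts attention to finitely many primes: \<open>p\<close> divides the order of
  \<open>tor p {}\<close>, which is the kernel of multiplication by \<open>p\<close> on
  \<open>G\<close>.\<close>

lemma prime_dvd_card:
  assumes "prime p" "tor_support p T \<noteq> {}"
  shows "p dvd card G"
proof -
  obtain i where "i \<in> tor_support p {}"
    using assms(2) tor_antimono[of "{}" T p] by (auto simp: tor_support_def)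
  then have "p dvd card (tor p {})" using card_tor_insert[OF assms(1)] by simp
  also have "card (tor p {}) dvd card G"
  proof -
    have "{g \<in> G. (\<lambda>i. cscale (int p) (g i)) = 0} = tor p {}" by (auto simp: tor_def fun_eq_iff)
    then show ?thesis
      using card_kernel_times_image[OF finite_G subgroup_G, of "\<lambda>g i. cscale (int p) (g i)"]
      by (simp add: fun_eq_iff cscale_diff_right)
  qed
  finally show ?thesis .
qed

text \<open>A nonzero \<open>g\<close> in the finite group \<open>G\<close> has an order k > 1. If k
  = p l with \<open>p\<close> prime, then l g is a nonzero p-torsion element that still vanishes on
  \<open>T\<close>.\<close>

lemma eq_0_if_rk_eq_0:
  assumes rk: "\<And>p. prime p \<Longrightarrow> p dvd card G \<Longrightarrow> rk p T = 0"
    and g: "g \<in> G" "\<forall>i\<in>T. g i = 0"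
  shows "g = 0"
proof (rule ccontr)
  assume "g \<noteq> 0"
  let ?c = "\<lambda>k::nat. (\<lambda>i. cscale (int k) (g i))"
  let ?P = "\<lambda>k. k > 0 \<and> ?c k = 0"
  have memG: "?c k \<in> G" for k using cscale_mem_subgroup[OF subgroup_G g(1)] .
  then have "finite (range ?c)" using finite_G by (meson finite_subset image_subsetI)
  then have "\<not> inj ?c" using finite_imageD infinite_UNIV_nat by blast
  then obtain k l where "k < l" "?c k = ?c l"
    by (metis (no_types, lifting) injI linorder_neqE_nat)
  then have "?P (l - k)" by (auto simp: fun_eq_iff of_nat_diff cscale_diff_left)
  then have P: "?P (LEAST k. ?P k)" by (rule LeastI)
  define k where "k = (LEAST k. ?P k)"
  have k: "k > 0" "?c k = 0" using P by (simp_all add: k_def)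
  have "k \<noteq> 1" using k(2) \<open>g \<noteq> 0\<close> by (auto simp: fun_eq_iff)
  then obtain p where p: "prime p" "p dvd k" using prime_factor_nat by blast
  then obtain l where l: "k = p * l" by (auto elim: dvdE)
  have "l > 0" "l < k" using k(1) l p(1) prime_gt_1_nat[of p] by (auto intro!: Nat.gr0I)
  then have "?c l \<noteq> 0" using not_less_Least[of l ?P] by (auto simp: k_def)
  moreover have "?c l \<in> tor p T"
    using memG k(2) l g(2) by (auto simp: tor_def cscale_cscale fun_eq_iff)
  ultimately have ne: "tor_support p T \<noteq> {}" by (auto simp: tor_support_def fun_eq_iff)
  then show False using rk[OF p(1) prime_dvd_card] rk_eq_0_iff p(1) by blast
qed

text \<open>The product of these primes divides \<open>card G\<close>, which is at most
  \<open>n ^ n\<close> by the Dirichlet bound for the full set of coordinates.\<close>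

lemma large_prime_count:
  assumes P: "P > 1" and n: "n > 0"
  shows "card {p. prime p \<and> p dvd card G \<and> P \<le> p} \<le> n * ln n / ln (real P)"
proof -
  let ?Q = "{p. prime p \<and> p dvd card G \<and> P \<le> p}"
  have cG: "card G > 0" using finite_G add_subgroup_0[OF subgroup_G] by (auto simp: card_gt_0_iff)
  have fin: "finite ?Q" using cG by (intro finite_subset[OF _ finite_divisors_nat[OF cG]]) auto
  have "\<Prod>Q dvd card G" if "finite Q" "Q \<subseteq> ?Q" for Q
    using that
  proof (induction Q rule: finite_induct)
    case (insert p Q)
    have "coprime p (\<Prod>Q)"
      using insert by (intro prod_coprime_right) (metis (no_types, lifting) insert_subset mem_Collect_eq primes_coprime subsetD)
    then show ?case using insert by (auto intro: divides_mult)
  qed simp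
  then have dvd: "\<Prod>?Q dvd card G" using fin by blast
  have "P ^ card ?Q = (\<Prod>p\<in>?Q. P)" by simp
  also have "\<dots> \<le> \<Prod>?Q" by (intro prod_mono) auto
  also have "\<dots> \<le> card G" using dvd cG by (rule dvd_imp_le)
  also have "\<dots> \<le> card {..<n} ^ card {..<n}"
    using subgroup_G support_G by (intro card_subgroup_le_support_power) (auto simp: not_less)
  finally have "P ^ card ?Q \<le> n ^ n" by simp
  then have "real P ^ card ?Q \<le> real n ^ n" by (metis of_nat_le_iff of_nat_power)
  then have "ln (real P ^ card ?Q) \<le> ln (real n ^ n)" using P n by (subst ln_le_cancel_iff) auto
  then have "card ?Q * ln (real P) \<le> n * ln n" using P n by (simp add: ln_realpow)
  then show ?thesis using P by (simp add: pos_le_divide_eq)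
qed

text \<open>The three terms are \<open>t\<close> greedy coordinates for the primes from
  \<open>P\<close> on, rank at most \<open>m\<close> for each of the fewer than \<open>P\<close>
  primes below \<open>P\<close>, and the rank left over at the large primes. The last two are
  removed by \<open>rk_sum_exhaust\<close>.\<close>

theorem injective_coordinates:
  assumes P: "P > 1" and n: "n > 0" and w: "w > 0" "w * ln (real m * w) \<le> ln (real P)"
  shows "\<exists>T\<subseteq>{..<n}. (\<forall>g\<in>G. (\<forall>i\<in>T. g i = 0) \<longrightarrow> g = 0) \<and>
    real (card T) \<le> t + m * P + exp (- (real t * w / n)) * (m * (n * ln n / ln (real P)))"
proof -
  let ?A = "{p. prime p \<and> p dvd card G}"
  let ?Q = "{p. prime p \<and> p dvd card G \<and> P \<le> p}"
  have cG: "card G > 0" using finite_G add_subgroup_0[OF subgroup_G] by (auto simp: card_gt_0_iff)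
  have finA: "finite ?A" by (intro finite_subset[OF _ finite_divisors_nat[OF cG]]) auto
  have finQ: "finite ?Q" by (rule finite_subset[OF _ finA]) auto
  have "w * ln (real m * w) \<le> ln (real p)" if "P \<le> p" for p
  proof -
    have "ln (real P) \<le> ln (real p)" using that P by simp
    then show ?thesis using w(2) by simp
  qed
  then obtain T0 where T0: "T0 \<subseteq> {..<n}" "card T0 \<le> t"
      "(\<Sum>p\<in>?Q. rk p T0) \<le> exp (- (t * w / n)) * (\<Sum>p\<in>?Q. rk p {})"
    using rk_sum_greedy[OF finQ _ w(1) n, of t] by auto
  have "(\<Sum>p\<in>?Q. rk p {}) \<le> (\<Sum>p\<in>?Q. real m)" using rk_le by (intro sum_mono) auto
  also have "\<dots> \<le> m * (n * ln n / ln (real P))"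
    using mult_left_mono[OF large_prime_count[OF P n], of "real m"] by (simp add: mult.commute)
  finally have "exp (- (t * w / n)) * (\<Sum>p\<in>?Q. rk p {}) \<le> exp (- (t * w / n)) * (m * (n * ln n / ln (real P)))"
    by (intro mult_left_mono) auto
  with T0(3) have large: "(\<Sum>p\<in>?Q. rk p T0) \<le> exp (- (t * w / n)) * (m * (n * ln n / ln (real P)))"
    by linarith
  have "(\<Sum>p\<in>?A - ?Q. rk p T0) \<le> (\<Sum>p\<in>?A - ?Q. real m)" using rk_le by (intro sum_mono) auto
  also have "\<dots> = card (?A - ?Q) * real m" by simp
  also have "\<dots> \<le> P * real m"
  proof -
    have "card (?A - ?Q) \<le> card {..<P}" by (intro card_mono) auto
    then show ?thesis by (intro mult_right_mono) auto
  qed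
  finally have small: "(\<Sum>p\<in>?A - ?Q. rk p T0) \<le> m * P" by (simp add: mult.commute)
  have "(\<Sum>p\<in>?A. rk p T0) = (\<Sum>p\<in>?A - ?Q. rk p T0) + (\<Sum>p\<in>?Q. rk p T0)"
    using finA by (intro sum.subset_diff) auto
  moreover obtain T where T: "T \<subseteq> {..<n}" "real (card T) \<le> card T0 + (\<Sum>p\<in>?A. rk p T0)"
      "(\<Sum>p\<in>?A. rk p T) = 0"
    using rk_sum_exhaust[OF finA _ T0(1)] by auto
  moreover have "rk p T = 0" if "prime p" "p dvd card G" for p
    using T(3) that rk_nonneg finA by (subst (asm) sum_nonneg_eq_0_iff) auto
  then have "\<forall>g\<in>G. (\<forall>i\<in>T. g i = 0) \<longrightarrow> g = 0" using eq_0_if_rk_eq_0 by blast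
  ultimately show ?thesis using T0(2) large small by (intro exI[of _ T]) auto
qed

end

section \<open>Bases extending a set of unit vectors\<close>

lemma int_comb_carrier [simp]: "int_comb n bs c \<in> carrier_vec n"
  unfolding int_comb_def by (simp add: carrier_vecI)

lemma int_comb_index:
  assumes "i < n" "c \<in> carrier_vec (length bs)" "set bs \<subseteq> carrier_vec n"
  shows "int_comb n bs c $ i = (\<Sum>j<length bs. of_int (c $ j) * bs ! j $ i)"
  using assms unfolding int_comb_def
  by (auto simp: scalar_prod_def mat_of_cols_index atLeast0LessThan intro!: sum.cong)

lemma int_comb_snoc:
  assumes bs: "set bs \<subseteq> carrier_vec n" and v: "v \<in> carrier_vec n"
    and c: "c \<in> carrier_vec (Suc (length bs))"
  shows "int_comb n (bs @ [v]) c =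
    int_comb n bs (vec (length bs) (($) c)) + of_int (c $ length bs) \<cdot>\<^sub>v v" (is "?l = ?r")
proof (rule eq_vecI)
  show "dim_vec ?l = dim_vec ?r" using v by (simp add: int_comb_def)
next
  fix i assume "i < dim_vec ?r"
  then have i: "i < n" using v by simp
  show "?l $ i = ?r $ i"
    using i bs v c by (simp add: int_comb_index nth_append)
qed

text \<open>One step of the Hermite normal form.\<close>

lemma is_lattice_basis_snoc:
  assumes basis: "is_lattice_basis n bs {x \<in> L. x $ t = 0}" and t: "t < n"
    and L: "L \<subseteq> carrier_vec n" "\<And>x y k. x \<in> L \<Longrightarrow> y \<in> L \<Longrightarrow> x + of_int k \<cdot>\<^sub>v y \<in> L"
    and v: "v \<in> L" "v $ t \<noteq> 0" and dvd: "\<And>x. x \<in> L \<Longrightarrow> \<exists>k. x $ t = of_int k * v $ t"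
  shows "is_lattice_basis n (bs @ [v]) L"
proof -
  let ?r = "length bs"
  have bs: "set bs \<subseteq> carrier_vec n" and span: "int_span n bs = {x \<in> L. x $ t = 0}"
    and inj: "inj_on (int_comb n bs) (carrier_vec ?r)"
    using basis by (auto simp: is_lattice_basis_def)
  have vc: "v \<in> carrier_vec n" using v L by auto
  have comb: "int_comb n bs c \<in> L \<and> int_comb n bs c $ t = 0" if "c \<in> carrier_vec ?r" for c
    using span that unfolding int_span_def by auto
  have "int_span n (bs @ [v]) \<subseteq> L"
    using L(2) v(1) comb by (auto simp: int_span_def int_comb_snoc[OF bs vc])
  moreover have "x \<in> int_span n (bs @ [v])" if x: "x \<in> L" for x
  proof -
    obtain k where k: "x $ t = of_int k * v $ t" using dvd x by auto
    have xc: "x \<in> carrier_vec n" using x L by auto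
    \<comment> \<open>Subtracting a multiple of \<open>v\<close> clears entry \<open>t\<close>,
      which leads back to the sublattice spanned by \<open>bs\<close>.\<close>
    have "x + of_int (-k) \<cdot>\<^sub>v v \<in> {x \<in> L. x $ t = 0}"
      using L(2)[OF x v(1), of "-k"] k t xc vc by simp
    then obtain c where c: "c \<in> carrier_vec ?r" "x + of_int (-k) \<cdot>\<^sub>v v = int_comb n bs c"
      using span unfolding int_span_def by blast
    define c' where "c' = vec (Suc ?r) (\<lambda>j. if j < ?r then c $ j else k)"
    have "vec ?r (($) c') = c" using c(1) by (auto simp: c'_def)
    then have "int_comb n (bs @ [v]) c' = (x + of_int (-k) \<cdot>\<^sub>v v) + of_int k \<cdot>\<^sub>v v"
      using int_comb_snoc[OF bs vc, of c'] c by (simp add: c'_def)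
    also have "\<dots> = x" using xc vc by (intro eq_vecI) auto
    finally show ?thesis unfolding int_span_def
      by (intro image_eqI[of _ _ c']) (auto simp: c'_def)
  qed
  moreover have "inj_on (int_comb n (bs @ [v])) (carrier_vec (Suc ?r))"
  proof (rule inj_onI)
    fix c d assume c: "c \<in> carrier_vec (Suc ?r)" and d: "d \<in> carrier_vec (Suc ?r)"
      and eq: "int_comb n (bs @ [v]) c = int_comb n (bs @ [v]) d"
    let ?c = "vec ?r (($) c)" and ?d = "vec ?r (($) d)"
    have eq': "int_comb n bs ?c + of_int (c $ ?r) \<cdot>\<^sub>v v = int_comb n bs ?d + of_int (d $ ?r) \<cdot>\<^sub>v v"
      using eq int_comb_snoc[OF bs vc c] int_comb_snoc[OF bs vc d] by simp
    \<comment> \<open>Combinations of \<open>bs\<close> vanish at entry \<open>t\<close> and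
      \<open>v\<close> does not, so this entry determines the last coefficient.\<close>
    then have "(int_comb n bs ?c + of_int (c $ ?r) \<cdot>\<^sub>v v) $ t = (int_comb n bs ?d + of_int (d $ ?r) \<cdot>\<^sub>v v) $ t"
      by simp
    then have last: "c $ ?r = d $ ?r"
      using t vc comb[of ?c] comb[of ?d] v(2) by auto
    have "int_comb n bs ?c = int_comb n bs ?d"
    proof (rule eq_vecI)
      fix i assume "i < dim_vec (int_comb n bs ?d)"
      then have i: "i < n" by (simp add: int_comb_def)
      have "(int_comb n bs ?c + of_int (c $ ?r) \<cdot>\<^sub>v v) $ i = (int_comb n bs ?d + of_int (d $ ?r) \<cdot>\<^sub>v v) $ i"
        using eq' by simp
      then show "int_comb n bs ?c $ i = int_comb n bs ?d $ i"
        using i vc last by auto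
    qed (simp add: int_comb_def)
    then have "?c = ?d" using inj by (auto dest: inj_onD)
    then have "c $ i = d $ i" if "i < ?r" for i
      using that by (metis index_vec)
    then show "c = d" using c d last by (intro eq_vecI) (auto simp: less_Suc_eq)
  qed
  ultimately show ?thesis using bs vc by (auto simp: is_lattice_basis_def)
qed

text \<open>Unit vectors are appended one at a time by \<open>is_lattice_basis_snoc\<close>; their
  entry 1 divides every integer.\<close>

lemma unit_vecs_basis:
  assumes "distinct ss" "set ss \<subseteq> {..<n}"
  shows "is_lattice_basis n (map (unit_vec n) ss)
    {x \<in> carrier_vec n. \<forall>i<n. x $ i \<in> \<int> \<and> (i \<notin> set ss \<longrightarrow> x $ i = 0)}"
  using assms
proof (induction ss rule: rev_induct)
  case Nil
  have "int_comb n [] ` carrier_vec 0 = {0\<^sub>v n}"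
    by (auto simp: int_comb_def scalar_prod_def intro!: image_eqI[of _ _ "0\<^sub>v 0"] eq_vecI)
  moreover have "{x \<in> carrier_vec n. \<forall>i<n. x $ i \<in> \<int> \<and> x $ i = (0::real)} = {0\<^sub>v n}"
    by auto
  ultimately show ?case by (auto simp: is_lattice_basis_def int_span_def inj_on_def)
next
  case (snoc t ss)
  let ?L = "{x \<in> carrier_vec n. \<forall>i<n. x $ i \<in> \<int> \<and> (i \<notin> set (ss @ [t]) \<longrightarrow> x $ i = (0::real))}"
  have "{x \<in> ?L. x $ t = 0} = {x \<in> carrier_vec n. \<forall>i<n. x $ i \<in> \<int> \<and> (i \<notin> set ss \<longrightarrow> x $ i = 0)}"
    using snoc.prems by auto
  then have "is_lattice_basis n (map (unit_vec n) ss @ [unit_vec n t]) ?L"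
  proof (intro is_lattice_basis_snoc[where t = t])
    fix x assume "x \<in> ?L"
    then have "x $ t \<in> \<int>" using snoc.prems by auto
    then show "\<exists>k. x $ t = of_int k * unit_vec n t $ t" using snoc.prems by (auto elim: Ints_cases)
  qed (use snoc in auto)
  then show ?case by simp
qed

text \<open>Induction on \<open>ts\<close>: a basis of the sublattice with entry \<open>t\<close>
  equal to 0 is completed by a vector of \<open>L\<close> with least positive entry at
  \<open>t\<close>. The common denominator \<open>q\<close> guarantees that a least one
  exists.\<close>

lemma lattice_basis_extend:
  assumes "is_lattice_basis n bs {x \<in> L. \<forall>t\<in>set ts. x $ t = 0}"
    and "distinct ts" "set ts \<subseteq> {..<n}" "unit_vec n ` set ts \<subseteq> L"
    and "L \<subseteq> carrier_vec n" "\<And>x y k. x \<in> L \<Longrightarrow> y \<in> L \<Longrightarrow> x + of_int k \<cdot>\<^sub>v y \<in> L"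
    and q: "q > (0::nat)" "\<And>x i. x \<in> L \<Longrightarrow> i < n \<Longrightarrow> of_nat q * x $ i \<in> \<int>"
  shows "\<exists>vs. set vs \<subseteq> L \<and> length vs = length ts \<and> is_lattice_basis n (bs @ vs) L"
  using assms(1-6) q(2)
proof (induction ts arbitrary: L)
  case Nil
  then show ?case by (intro exI[of _ "[]"]) simp
next
  case (Cons t ts)
  let ?M = "{x \<in> L. x $ t = 0}"
  have t: "t < n" using Cons.prems(3) by simp
  note closed = Cons.prems(6)
  have "{x \<in> L. \<forall>s\<in>set (t # ts). x $ s = 0} = {x \<in> ?M. \<forall>s\<in>set ts. x $ s = 0}" by auto
  then have M1: "is_lattice_basis n bs {x \<in> ?M. \<forall>s\<in>set ts. x $ s = 0}"
    using Cons.prems(1) by simp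
  have "unit_vec n s $ t = (0::real)" if "s \<in> set ts" for s
    using Cons.prems(2,3) that t by auto
  then have M2: "unit_vec n ` set ts \<subseteq> ?M"
    using Cons.prems(4) by auto
  have M3: "?M \<subseteq> carrier_vec n" using Cons.prems(5) by blast
  have M4: "x + of_int k \<cdot>\<^sub>v y \<in> ?M" if "x \<in> ?M" "y \<in> ?M" for x y k
  proof -
    have "x \<in> carrier_vec n" "y \<in> carrier_vec n" using that Cons.prems(5) by blast+
    then show ?thesis using that closed[of x y k] t by simp
  qed
  have M5: "real q * x $ i \<in> \<int>" if "x \<in> ?M" "i < n" for x i
    using Cons.prems(7) that by simp
  have "distinct ts" "set ts \<subseteq> {..<n}" using Cons.prems(2,3) by simp_all
  from Cons.IH[OF M1 this M2 M3 M4 M5]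
  obtain vs where vs: "set vs \<subseteq> ?M" "length vs = length ts"
      "is_lattice_basis n (bs @ vs) ?M" by blast
  \<comment> \<open>\<open>P k\<close> says that k/q occurs as a positive entry at \<open>t\<close>;
    the unit vector shows \<open>P q\<close>.\<close>
  define P where "P k \<longleftrightarrow> k > 0 \<and> (\<exists>x\<in>L. real q * x $ t = real k)" for k :: nat
  have "unit_vec n t \<in> L" using Cons.prems(4) by simp
  then have "P q" unfolding P_def using t q(1) by (intro conjI bexI[of _ "unit_vec n t"]) simp_all
  then have Pk: "P (LEAST k. P k)" by (rule LeastI)
  define k where "k = (LEAST k. P k)"
  have min: "\<not> P l" if "l < k" for l using that not_less_Least k_def by blast
  obtain v where v: "v \<in> L" "real q * v $ t = real k" "k > 0" using Pk by (auto simp: P_def k_def)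
  have dvd: "\<exists>j. x $ t = of_int j * v $ t" if x: "x \<in> L" for x
  proof -
    obtain a where a: "real q * x $ t = of_int a" using Cons.prems(7)[OF x t] by (auto elim: Ints_cases)
    \<comment> \<open>Division with remainder: entry \<open>t\<close> of \<open>?y\<close> is (a mod
      k)/q, and minimality of \<open>k\<close> makes it 0.\<close>
    let ?y = "x + of_int (- (a div int k)) \<cdot>\<^sub>v v"
    have "x \<in> carrier_vec n" "v \<in> carrier_vec n" using Cons.prems(5) x v(1) by auto
    then have "real q * ?y $ t = real q * x $ t - of_int (a div int k) * (real q * v $ t)"
      using t by (simp add: algebra_simps)
    also have "\<dots> = of_int a - of_int (a div int k) * real k" unfolding a v(2) by simp
    also have "\<dots> = of_int (a - (a div int k) * int k)" by simp
    also have "\<dots> = of_int (a mod int k)" by (simp add: minus_div_mult_eq_mod)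
    finally have "real q * ?y $ t = real (nat (a mod int k))" using v(3) by simp
    moreover have "nat (a mod int k) < k" using v(3) by (simp add: nat_less_iff)
    moreover have "?y \<in> L" using closed[OF x v(1)] .
    ultimately have "nat (a mod int k) = 0" using min[of "nat (a mod int k)"] unfolding P_def by (metis gr0I)
    moreover have "0 \<le> a mod int k" using v(3) by simp
    ultimately have "a mod int k = 0" by linarith
    then have "a = (a div int k) * int k" using div_mult_mod_eq[of a "int k"] by simp
    then have "(of_int a :: real) = of_int ((a div int k) * int k)" by (rule arg_cong)
    then have "real q * x $ t = of_int (a div int k) * (real q * v $ t)" 
      unfolding a v(2) by simp
    then have "x $ t = of_int (a div int k) * v $ t" using q(1) by simp
    then show ?thesis by blast
  qed
  have "v $ t \<noteq> 0" using v(2,3) by auto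
  from is_lattice_basis_snoc[OF vs(3) t Cons.prems(5) closed v(1) this dvd]
  have "is_lattice_basis n ((bs @ vs) @ [v]) L" .
  then show ?case using vs v(1) by (intro exI[of _ "vs @ [v]"]) auto
qed

text \<open>The vectors of \<open>L\<close> that vanish on \<open>T\<close> are integral, so the
  unit vectors outside \<open>T\<close> form a basis of that sublattice. Extending it to
  \<open>L\<close> adds exactly \<open>card T\<close> vectors.\<close>

lemma defect_le_card:
  assumes L: "L \<subseteq> carrier_vec n" "\<And>x y k. x \<in> L \<Longrightarrow> y \<in> L \<Longrightarrow> x + of_int k \<cdot>\<^sub>v y \<in> L"
    and int: "{x \<in> carrier_vec n. \<forall>i<n. x $ i \<in> \<int>} \<subseteq> L"
    and q: "q > (0::nat)" "\<And>x i. x \<in> L \<Longrightarrow> i < n \<Longrightarrow> of_nat q * x $ i \<in> \<int>"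
    and T: "T \<subseteq> {..<n}" "\<And>x. x \<in> L \<Longrightarrow> \<forall>i\<in>T. x $ i = 0 \<Longrightarrow> \<forall>i<n. x $ i \<in> \<int>"
  shows "defect n L \<le> card T"
proof -
  have fin: "finite T" using T(1) finite_subset by blast
  define ts ss where "ts = sorted_list_of_set T" and "ss = sorted_list_of_set ({..<n} - T)"
  have ts: "distinct ts" "set ts = T" "length ts = card T" 
    and ss: "distinct ss" "set ss = {..<n} - T" "length ss = n - card T"
    using fin T(1) by (auto simp: ts_def ss_def card_Diff_subset)
  have cT: "card T \<le> n" using T(1) card_mono[of "{..<n}" T] by simp
  let ?es = "map (unit_vec n) ss :: real vec list"
  have "{x \<in> L. \<forall>t\<in>set ts. x $ t = 0} =
      {x \<in> carrier_vec n. \<forall>i<n. x $ i \<in> \<int> \<and> (i \<notin> set ss \<longrightarrow> x $ i = 0)}"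
    using T L(1) int ts ss by auto
  then have "is_lattice_basis n ?es {x \<in> L. \<forall>t\<in>set ts. x $ t = 0}"
    using unit_vecs_basis[OF ss(1), of n] ss(2) by auto
  moreover have "unit_vec n ` set ts \<subseteq> L"
  proof (intro image_subsetI subsetD[OF int])
    fix i assume "i \<in> set ts"
    show "unit_vec n i \<in> {x \<in> carrier_vec n. \<forall>i<n. x $ i \<in> (\<int> :: real set)}"
      by (auto simp: unit_vec_def)
  qed
  ultimately obtain vs where vs: "set vs \<subseteq> L" "length vs = card T" "is_lattice_basis n (?es @ vs) L"
    using lattice_basis_extend[OF _ ts(1) _ _ L q, of ?es] ts T(1) by auto
  have "inj_on (unit_vec n :: nat \<Rightarrow> real vec) {..<n}"
    by (auto simp: inj_on_def)
  then have "distinct ?es"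
    using ss by (auto simp: distinct_map intro: inj_on_subset)
  moreover have "set ?es \<subseteq> set (unit_vecs n)" using ss by (auto simp: unit_vecs_def)
  ultimately show ?thesis unfolding defect_def using vs cT ss(3)
    by (intro Least_le exI[of _ ?es] exI[of _ vs]) simp
qed

section \<open>Choice of the parameters\<close>

text \<open>Amounts to e < 3: exp (1/4) is at most 1 + 1/4 + 1/16 = 21/16, whose fourth power is
  below 3.\<close>

lemma ln_ln_3: "0 < ln (ln (3::real))"
proof -
  have "exp (1::real) = exp (1 / 4) ^ 4" by (simp flip: exp_of_nat_mult)
  also have "\<dots> \<le> (21 / 16) ^ 4"
    using exp_bound[of "1 / 4"] by (intro power_mono) (simp_all add: power2_eq_square)
  also have "\<dots> < 3" by (simp add: power4_eq_xxxx)
  finally have "1 < ln (3::real)" using ln_less_cancel_iff[of "exp 1" "3::real"] by simp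
  then show ?thesis by simp
qed

text \<open>Bernoulli's inequality with n/m \<ge> 1 + 2/m. It keeps the iterated logarithm in the
  claimed bound at least ln (ln 3) > 0.\<close>

lemma power_ge_3:
  assumes "0 < m" "m + 1 < n"
  shows "3 \<le> (real n / real m) ^ m"
proof -
  have "1 + real m * (2 / real m) \<le> (1 + 2 / real m) ^ m"
    by (rule Bernoulli_inequality) (rule order_trans[of _ 0], simp_all)
  also have "\<dots> \<le> (real n / real m) ^ m"
  proof (rule power_mono)
    have "1 + 2 / real m = (real m + 2) / real m" using assms by (simp add: field_simps)
    also have "\<dots> \<le> real n / real m" using assms by (intro divide_right_mono) auto
    finally show "1 + 2 / real m \<le> real n / real m" .
  qed simp
  finally show ?thesis using assms by simp
qed

text \<open>If \<open>n\<close> is at most a fixed power of \<open>m + 1\<close>, then the claimed bound exceeds a multiple of \<open>n\<close>;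
  otherwise \<open>P\<close>, \<open>w\<close> and \<open>t\<close> are chosen as about \<open>sqrt (n / m)\<close>, \<open>ln n / ln (m ln n)\<close> and
  \<open>(n / w) ln (m ln n)\<close>.\<close>

lemma optimize_parameters:
  defines "C \<equiv> max (4 / (ln (ln 3))\<^sup>2) (60 / ln 2)"
  assumes mn: "0 < m" "m + 1 < n" and triv: "d \<le> real n"
    and bound: "\<And>P t :: nat. \<And>w :: real. P > 1 \<Longrightarrow> w > 0 \<Longrightarrow> w * ln (real m * w) \<le> ln (real P) \<Longrightarrow>
      d \<le> t + m * P + exp (- (real t * w / n)) * (m * (n * ln n / ln (real P)))"
  shows "d \<le> C * (real n * ln (real m + 1) / ln (real n / real m)) *
        (ln (ln ((real n / real m) ^ m)))\<^sup>2"
proof -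
  define L where "L = ln (real n / real m)"
  define l where "l = ln (real m * L)"
  have y: "real n / real m > 1" using mn by (simp add: field_simps)
  have L0: "L > 0" using y by (simp add: L_def)
  have mL: "ln ((real n / real m) ^ m) = real m * L"
    using y by (subst ln_realpow) (auto simp: L_def)
  have "ln 3 \<le> ln ((real n / real m) ^ m)"
    using power_ge_3[OF mn] y by (subst ln_le_cancel_iff) auto
  then have mL3: "ln 3 \<le> real m * L" using mL by simp
  have ln31: "1 < ln (3::real)" using ln_ln_3 ln_gt_zero_imp_gt_one[of "ln (3::real)"] by simp
  have c0: "ln (ln 3) \<le> l" unfolding l_def using mL3 ln31 by (subst ln_le_cancel_iff) auto
  have l0: "l > 0" using c0 ln_ln_3 by linarith
  have goal: "C * (real n * ln (real m + 1) / ln (real n / real m)) * (ln (ln ((real n / real m) ^ m)))\<^sup>2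
     = C * (real n * ln (real m + 1) / L) * l\<^sup>2"
    by (simp only: mL l_def L_def)
  have lm: "ln 2 \<le> ln (real m + 1)" using mn by simp
  then have lm0: "0 < ln (real m + 1)" using ln_2_less_1 ln_gt_zero[of "2::real"] by linarith
  show ?thesis
  proof (cases "L \<le> 4 * ln (real m + 1)")
    case True
    \<comment> \<open>Here the bound d \<le> n suffices. Both factors below are at least 1, and
      their constants combine to the first entry of the maximum in \<open>C\<close>.\<close>
    have "1 \<le> 4 * ln (real m + 1) / L" using True L0 by (simp add: field_simps)
    moreover have "1 \<le> l\<^sup>2 / (ln (ln 3))\<^sup>2"
      using c0 ln_ln_3 by (simp add: power_mono)
    ultimately have "1 \<le> (4 * ln (real m + 1) / L) * (l\<^sup>2 / (ln (ln 3))\<^sup>2)"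
      using mult_mono[of 1 "4 * ln (real m + 1) / L" 1 "l\<^sup>2 / (ln (ln 3))\<^sup>2"] by simp
    then have "real n \<le> real n * ((4 * ln (real m + 1) / L) * (l\<^sup>2 / (ln (ln 3))\<^sup>2))"
      using mult_left_mono[OF _ of_nat_0_le_iff[of n]] by (metis mult_1_right)
    also have "\<dots> = 4 / (ln (ln 3))\<^sup>2 * (real n * ln (real m + 1) / L * l\<^sup>2)"
      by (simp add: field_simps)
    also have "\<dots> \<le> C * (real n * ln (real m + 1) / L * l\<^sup>2)"
      using L0 lm0 by (intro mult_right_mono) (auto simp: C_def)
    finally show ?thesis using triv unfolding goal by (simp only: mult.assoc)
  next
    case False
    then have L3: "L > 4 * ln (real m + 1)" by simp
    \<comment> \<open>From ln (1/2) \<le> 1/2 - 1. It yields the numerical bounds L \<ge> 2 and l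
      \<ge> 1/2.\<close>
    have ln2: "1 / 2 \<le> ln (2::real)" using ln_le_minus_one[of "1 / 2"] by (simp add: ln_div)
    have L2: "L \<ge> 2" using L3 lm ln2 by linarith
    have lnm: "0 \<le> ln (real m)" "ln (real m) \<le> ln (real m + 1)" using mn by auto
    have lnL: "ln 2 \<le> ln L" using L2 by simp
    have l_eq: "l = ln (real m) + ln L" unfolding l_def using mn L0 by (intro ln_mult_pos) auto
    have l_half: "l \<ge> 1 / 2" using l_eq lnm lnL ln2 by linarith
    have ln_n: "ln (real n) = ln (real m) + L" using mn by (simp add: L_def ln_div)
    have ln_n2: "ln (real n) \<le> 2 * L" using ln_n L3 lnm L0 by linarith
    have L_n: "L \<le> real n"
    proof -
      have "ln (real n) \<le> real n - 1" using mn by (intro ln_le_minus_one) auto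
      then show ?thesis using ln_n lnm by linarith
    qed
    define s where "s = sqrt (real n / real m)"
    define P where "P = nat \<lceil>s\<rceil>"
    \<comment> \<open>Since ln (m w) \<le> l, this choice gives w ln (m w) \<le> w l = L/2 = ln s
      \<le> ln P.\<close>
    define w where "w = L / (2 * l)"
    \<comment> \<open>Chosen so that t w / n \<ge> l, which brings the exponential factor down to
      exp (- l) = 1/(m L).\<close>
    define t where "t = nat \<lceil>2 * real n * l\<^sup>2 / L\<rceil>"
    have s1: "s > 1" using y by (simp add: s_def)
    have lns: "ln s = L / 2" using y by (simp add: s_def L_def ln_sqrt)
    have Ps: "s \<le> real P" "real P \<le> 2 * s" using s1 by (simp_all add: P_def) linarith+
    have P1: "P > 1" using Ps s1 by linarith
    have "ln s \<le> ln (real P)" using Ps s1 by (subst ln_le_cancel_iff) auto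
    then have lnP: "L / 2 \<le> ln (real P)" using lns by simp
    have w0: "w > 0" using L0 l0 by (simp add: w_def)
    have "ln (real m * w) \<le> l"
    proof -
      have "w \<le> L" using L0 l_half l0 by (simp add: w_def field_simps)
      then show ?thesis unfolding l_def using mn w0 L0 by (subst ln_le_cancel_iff) auto
    qed
    then have "w * ln (real m * w) \<le> w * l" using w0 by (intro mult_left_mono) auto
    also have "\<dots> = L / 2" using l0 by (simp add: w_def)
    finally have wP: "w * ln (real m * w) \<le> ln (real P)" using lnP by simp
    have le: "d \<le> t + m * P + exp (- (real t * w / n)) * (m * (n * ln n / ln (real P)))"
      by (rule bound[OF P1 w0 wP])
    \<comment> \<open>This absorbs the error 1 made by rounding \<open>t\<close> up.\<close>
    have "real n / L \<ge> 1" using L_n L0 by simp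
    have t: "real t \<le> 2 * real n * l\<^sup>2 / L + real n / L"
    proof -
      have "0 \<le> 2 * real n * l\<^sup>2 / L" using L0 by simp
      then have "real t \<le> 2 * real n * l\<^sup>2 / L + 1" unfolding t_def by linarith
      then show ?thesis using \<open>real n / L \<ge> 1\<close> by linarith
    qed
    have mP: "real (m * P) \<le> 2 * (real n / L)"
    proof -
      \<comment> \<open>The difference of the two sides is ((L - 2)^2 + 4)/8. The resulting L \<le>
        s gives m s L \<le> m s^2 = n.\<close>
      have "L \<le> 1 + L / 2 + (L / 2)\<^sup>2 / 2"
        using zero_le_power2[of "L - 2"] by (simp add: power2_eq_square algebra_simps)
      also have "\<dots> \<le> exp (L / 2)" using L0 by (intro exp_lower_Taylor_quadratic) auto
      also have "\<dots> = s" using s1 by (simp flip: lns)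
      finally have "L \<le> s" .
      have "real m * s * L \<le> real m * s * s" using \<open>L \<le> s\<close> s1 by (intro mult_left_mono) auto
      also have "\<dots> = real m * (s * s)" by simp
      also have "s * s = real n / real m" by (simp add: s_def)
      also have "real m * (real n / real m) = real n" using mn by simp
      finally have "real m * s \<le> real n / L" using L0 by (simp add: field_simps)
      moreover have "real m * real P \<le> real m * (2 * s)" using Ps by (intro mult_left_mono) auto
      ultimately show ?thesis by simp
    qed
    have "exp (- (real t * w / n)) * (m * (n * ln n / ln (real P))) \<le> 1 / (real m * L) * (m * (4 * real n))"
    proof (intro mult_mono)
      have "2 * real n * l\<^sup>2 / L \<le> real t" unfolding t_def by linarith
      then have "(2 * real n * l\<^sup>2 / L) * w / n \<le> real t * w / n"
        using w0 by (intro divide_right_mono mult_right_mono) auto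
      moreover have "(2 * real n * l\<^sup>2 / L) * w / n = l"
        using L0 l0 mn by (simp add: w_def power2_eq_square)
      ultimately have "exp (- (real t * w / n)) \<le> exp (- l)" by simp
      also have "\<dots> = 1 / (real m * L)" using mn L0 by (simp add: l_def exp_minus inverse_eq_divide)
      finally show "exp (- (real t * w / n)) \<le> 1 / (real m * L)" .
      have "ln (real n) \<le> 4 * ln (real P)" using ln_n2 lnP by linarith
      moreover have "0 < ln (real P)" using P1 by simp
      ultimately have "ln (real n) / ln (real P) \<le> 4" by (simp add: field_simps)
      then have "real n * (ln (real n) / ln (real P)) \<le> real n * 4" by (intro mult_left_mono) auto
      then show "real n * ln (real n) / ln (real P) \<le> 4 * real n" by simp
      show "0 \<le> real n * ln (real n) / ln (real P)" using P1 mn by simp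
      then show "0 \<le> real m * (real n * ln (real n) / ln (real P))"
        by (intro mult_nonneg_nonneg) auto
    qed (use L0 mn in auto)
    also have "\<dots> = 4 * (real n / L)" using mn by simp
    \<comment> \<open>The coefficient 7 is 1 from rounding \<open>t\<close>, 2 from
      \<open>m * P\<close> and 4 from the large primes.\<close>
    finally have "d \<le> 2 * real n * l\<^sup>2 / L + 7 * (real n / L)"
      using le t mP by simp
    also have "\<dots> \<le> 2 * real n * l\<^sup>2 / L + 28 * l\<^sup>2 * (real n / L)"
    proof -
      have "(1 / 2)\<^sup>2 \<le> l\<^sup>2" using l_half by (intro power_mono) auto
      then have "7 \<le> 28 * l\<^sup>2" by (simp add: power2_eq_square)
      then show ?thesis using L0 by (intro add_left_mono mult_right_mono) auto
    qed
    also have "\<dots> = 30 * (real n / L) * l\<^sup>2" by (simp add: field_simps)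
    \<comment> \<open>The factor ln (m + 1) enters through ln (m + 1) / ln 2 \<ge> 1.\<close>
    also have "\<dots> \<le> 60 / ln 2 * ln (real m + 1) * (real n / L) * l\<^sup>2"
    proof -
      have "30 \<le> 60 / ln 2 * ln (2::real)" by simp
      also have "\<dots> \<le> 60 / ln 2 * ln (real m + 1)" using lm by (intro mult_left_mono) auto
      finally show ?thesis using L0 by (intro mult_right_mono) auto
    qed
    also have "\<dots> \<le> C * ln (real m + 1) * (real n / L) * l\<^sup>2"
      using L0 lm0 by (intro mult_right_mono) (auto simp: C_def)
    finally show ?thesis unfolding goal by (simp add: algebra_simps)
  qed
qed

section \<open>The residue group of a lattice\<close>

lemma sum_lessThan_add:
  fixes f :: "nat \<Rightarrow> 'a::comm_monoid_add"
  shows "(\<Sum>j<n + m. f j) = (\<Sum>j<n. f j) + (\<Sum>j<m. f (n + j))"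
  by (induction m) (simp_all add: add.assoc)

lemma common_denominator:
  assumes "finite A" "A \<subseteq> (\<rat> :: real set)"
  shows "\<exists>q::nat. q > 0 \<and> (\<forall>a\<in>A. real q * a \<in> \<int>)"
  using assms
proof (induction A rule: finite_induct)
  case empty
  show ?case by (intro exI[of _ 1]) auto
next
  case (insert a A)
  then obtain q where q: "q > 0" "\<forall>a\<in>A. real q * a \<in> \<int>" by auto
  have "a \<in> \<rat>" using insert.prems by simp
  then obtain u v :: int where uv: "v > 0" "a = of_int u / of_int v" by (auto elim: Rats_cases')
  let ?q = "q * nat v"
  have "real ?q * a = of_int (int q * u)" using uv by simp
  then have "real ?q * a \<in> \<int>" by (metis Ints_of_int)
  moreover have "real ?q * b \<in> \<int>" if "b \<in> A" for b
  proof -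
    have "real ?q * b = of_int v * (real q * b)" using uv by simp
    then show ?thesis using q(2) that by (metis Ints_mult Ints_of_int)
  qed
  ultimately show ?case using q(1) uv(1) by (intro exI[of _ ?q]) auto
qed

text \<open>Coefficients are a function on all naturals, so that they can be shifted and combined
  without dimension conditions; only the first \<open>length gs\<close> of them count.\<close>

definition gen_comb :: "nat \<Rightarrow> real vec list \<Rightarrow> (nat \<Rightarrow> int) \<Rightarrow> real vec" where
  "gen_comb n gs c = vec n (\<lambda>i. \<Sum>j<length gs. of_int (c j) * gs ! j $ i)"

lemma gen_comb_carrier [simp]: "gen_comb n gs c \<in> carrier_vec n"
  by (simp add: gen_comb_def)

text \<open>The coefficients of the unit vectors absorb any integral difference, so membership
  becomes congruence modulo Z^n to a combination of \<open>gs\<close>.\<close>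

lemma int_span_unit_vecs_append:
  assumes gs: "set gs \<subseteq> carrier_vec n"
  shows "int_span n (unit_vecs n @ gs) =
    {x \<in> carrier_vec n. \<exists>c. \<forall>i<n. x $ i - gen_comb n gs c $ i \<in> \<int>}"
proof -
  let ?m = "length gs"
  have comb: "int_comb n (unit_vecs n @ gs) c $ i
      = of_int (c $ i) + gen_comb n gs (\<lambda>j. c $ (n + j)) $ i"
    if c: "c \<in> carrier_vec (n + ?m)" and i: "i < n" for c i
  proof -
    have "int_comb n (unit_vecs n @ gs) c $ i
        = (\<Sum>j<n + ?m. of_int (c $ j) * (unit_vecs n @ gs) ! j $ i)"
      using c i gs by (subst int_comb_index) (auto simp: unit_vecs_def)
    also have "\<dots> = (\<Sum>j<n. of_int (c $ j) * unit_vec n j $ i) + (\<Sum>j<?m. of_int (c $ (n + j)) * gs ! j $ i)"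
      by (simp add: sum_lessThan_add nth_append unit_vecs_def)
    also have "(\<Sum>j<n. of_int (c $ j) * unit_vec n j $ i) = (\<Sum>j<n. if j = i then of_int (c $ i) else (0::real))"
      using i by (intro sum.cong) auto
    finally show ?thesis using i by (simp add: gen_comb_def)
  qed
  show ?thesis
  proof (intro subset_antisym subsetI)
    fix x assume "x \<in> int_span n (unit_vecs n @ gs)"
    then obtain c where c: "c \<in> carrier_vec (n + ?m)" "x = int_comb n (unit_vecs n @ gs) c"
      by (auto simp: int_span_def unit_vecs_def)
    then show "x \<in> {x \<in> carrier_vec n. \<exists>c. \<forall>i<n. x $ i - gen_comb n gs c $ i \<in> \<int>}"
      using comb[OF c(1)] by (auto intro!: exI[of _ "\<lambda>j. c $ (n + j)"])
  next
    fix x assume "x \<in> {x \<in> carrier_vec n. \<exists>c. \<forall>i<n. x $ i - gen_comb n gs c $ i \<in> \<int>}"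
    then obtain c where x: "x \<in> carrier_vec n" and c: "\<forall>i<n. x $ i - gen_comb n gs c $ i \<in> \<int>" by auto
    define c' where "c' = vec (n + ?m) (\<lambda>j. if j < n then \<lfloor>x $ j - gen_comb n gs c $ j\<rfloor> else c (j - n))"
    have c': "c' \<in> carrier_vec (n + ?m)" by (simp add: c'_def)
    have "gen_comb n gs (\<lambda>j. c' $ (n + j)) = gen_comb n gs c"
      unfolding gen_comb_def by (intro eq_vecI) (auto simp: c'_def)
    moreover have "of_int (c' $ i) = x $ i - gen_comb n gs c $ i" if "i < n" for i
      using c that by (auto simp: c'_def)
    ultimately have "int_comb n (unit_vecs n @ gs) c' = x"
      using comb[OF c'] x by (intro eq_vecI) (auto simp: int_comb_def)
    then show "x \<in> int_span n (unit_vecs n @ gs)"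
      using c' by (auto simp: int_span_def unit_vecs_def)
  qed
qed

text \<open>The class of \<open>x\<close> modulo Z^n, padded by zeros to a function on all
  naturals.\<close>

definition residue :: "nat \<Rightarrow> real vec \<Rightarrow> nat \<Rightarrow> circle" where
  "residue n x = (\<lambda>i. if i < n then to_circle (x $ i) else 0)"

locale rational_lattice =
  fixes n m :: nat and L :: "real vec set" and gs :: "real vec list"
  assumes L_def: "L = int_span n (unit_vecs n @ gs)"
    and length_gs: "length gs = m" and rational_gs: "set gs \<subseteq> rational_vecs n"
begin

lemma L_iff: "x \<in> L \<longleftrightarrow> x \<in> carrier_vec n \<and> (\<exists>c. \<forall>i<n. x $ i - gen_comb n gs c $ i \<in> \<int>)"
proof -
  have "set gs \<subseteq> carrier_vec n" using rational_gs by (auto simp: rational_vecs_def)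
  then show ?thesis by (simp add: L_def int_span_unit_vecs_append)
qed

lemma L_carrier: "L \<subseteq> carrier_vec n"
  by (auto simp: L_iff)

lemma L_closed:
  assumes "x \<in> L" "y \<in> L"
  shows "x + of_int k \<cdot>\<^sub>v y \<in> L"
proof -
  obtain c d where x: "x \<in> carrier_vec n" "\<forall>i<n. x $ i - gen_comb n gs c $ i \<in> \<int>"
    and y: "y \<in> carrier_vec n" "\<forall>i<n. y $ i - gen_comb n gs d $ i \<in> \<int>"
    using assms unfolding L_iff by blast
  have "(x + of_int k \<cdot>\<^sub>v y) $ i - gen_comb n gs (\<lambda>j. c j + k * d j) $ i \<in> \<int>" if i: "i < n" for i
  proof -
    have "gen_comb n gs (\<lambda>j. c j + k * d j) $ i = gen_comb n gs c $ i + of_int k * gen_comb n gs d $ i"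
      using i by (simp add: gen_comb_def sum.distrib sum_distrib_left algebra_simps)
    then have "(x + of_int k \<cdot>\<^sub>v y) $ i - gen_comb n gs (\<lambda>j. c j + k * d j) $ i =
        (x $ i - gen_comb n gs c $ i) + of_int k * (y $ i - gen_comb n gs d $ i)"
      using x y i by (simp add: algebra_simps)
    also have "\<dots> \<in> \<int>" using x(2) y(2) i by (intro Ints_add Ints_mult) auto
    finally show ?thesis .
  qed
  then show ?thesis unfolding L_iff using x(1) y(1) by (intro conjI exI[of _ "\<lambda>j. c j + k * d j"]) auto
qed

lemma integral_in_L: "{x \<in> carrier_vec n. \<forall>i<n. x $ i \<in> \<int>} \<subseteq> L"
proof
  fix x :: "real vec" assume "x \<in> {x \<in> carrier_vec n. \<forall>i<n. x $ i \<in> \<int>}"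
  then show "x \<in> L" unfolding L_iff by (intro conjI exI[of _ "\<lambda>_. 0"]) (auto simp: gen_comb_def)
qed

lemma denominator: "\<exists>q::nat. q > 0 \<and> (\<forall>x\<in>L. \<forall>i<n. real q * x $ i \<in> \<int>)"
proof -
  let ?A = "(\<lambda>(j, i). gs ! j $ i) ` ({..<m} \<times> {..<n})"
  have "gs ! j $ i \<in> \<rat>" if "j < m" "i < n" for i j
  proof -
    have "gs ! j \<in> rational_vecs n" using that(1) rational_gs length_gs nth_mem[of j gs] by blast
    then show ?thesis using that(2) by (simp add: rational_vecs_def)
  qed
  then have "?A \<subseteq> \<rat>" by auto
  then obtain q where q: "q > 0" "\<forall>a\<in>?A. real q * a \<in> \<int>"
    using common_denominator[of ?A] by auto
  have "real q * x $ i \<in> \<int>" if x: "x \<in> L" and i: "i < n" for x i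
  proof -
    obtain c where c: "x $ i - gen_comb n gs c $ i \<in> \<int>" using x i unfolding L_iff by blast
    have "real q * gen_comb n gs c $ i = (\<Sum>j<m. of_int (c j) * (real q * gs ! j $ i))"
      using i by (simp add: gen_comb_def length_gs sum_distrib_left algebra_simps)
    also have "\<dots> \<in> \<int>"
    proof (rule Ints_sum)
      fix j assume "j \<in> {..<m}"
      then have "real q * gs ! j $ i \<in> \<int>" using q(2) i by auto
      then show "of_int (c j) * (real q * gs ! j $ i) \<in> \<int>" by (rule Ints_mult[OF Ints_of_int])
    qed
    finally have "real q * gen_comb n gs c $ i + real q * (x $ i - gen_comb n gs c $ i) \<in> \<int>"
      using Ints_mult[OF Ints_of_nat c] by (rule Ints_add)
    then show ?thesis by (simp add: algebra_simps)
  qed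
  with q(1) show ?thesis by blast
qed

lemma defect_le:
  assumes "T \<subseteq> {..<n}" "\<And>x. x \<in> L \<Longrightarrow> \<forall>i\<in>T. x $ i = 0 \<Longrightarrow> \<forall>i<n. x $ i \<in> \<int>"
  shows "defect n L \<le> card T"
proof -
  obtain q where "q > (0::nat)" "\<And>x i. x \<in> L \<Longrightarrow> i < n \<Longrightarrow> real q * x $ i \<in> \<int>"
    using denominator by auto
  from defect_le_card[OF L_carrier L_closed integral_in_L this assms] show ?thesis .
qed

lemma defect_le_dim: "defect n L \<le> n"
  using defect_le[of "{..<n}"] by simp

text \<open>Integral vectors have residue 0, so the residue group is generated by the residues of
  \<open>gs\<close>.\<close>

lemma residue_image: "residue n ` L = range (\<lambda>c. residue n (gen_comb n gs c))"
proof (intro subset_antisym subsetI)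
  fix g assume "g \<in> residue n ` L"
  then obtain x where g: "g = residue n x" and x: "x \<in> L" by (rule imageE)
  obtain c where c: "\<forall>i<n. x $ i - gen_comb n gs c $ i \<in> \<int>" using x unfolding L_iff by blast
  have "to_circle (x $ i) = to_circle (gen_comb n gs c $ i)" if "i < n" for i
  proof -
    have "to_circle (x $ i) - to_circle (gen_comb n gs c $ i) = 0"
      unfolding to_circle_diff[symmetric] to_circle_eq_0_iff using c that by blast
    then show ?thesis by simp
  qed
  then have "g = residue n (gen_comb n gs c)" by (simp add: g residue_def fun_eq_iff)
  then show "g \<in> range (\<lambda>c. residue n (gen_comb n gs c))" by blast
next
  fix g assume "g \<in> range (\<lambda>c. residue n (gen_comb n gs c))"
  then obtain c where g: "g = residue n (gen_comb n gs c)" by blast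
  have "gen_comb n gs c \<in> L" unfolding L_iff by (intro conjI exI[of _ c]) auto
  then show "g \<in> residue n ` L" using g by blast
qed

lemma residue_group: "add_subgroup (residue n ` L)"
  unfolding add_subgroup_def
proof (intro conjI ballI)
  have "0\<^sub>v n \<in> L" by (intro subsetD[OF integral_in_L]) auto
  moreover have "0 = residue n (0\<^sub>v n)" by (auto simp: residue_def fun_eq_iff)
  ultimately show "0 \<in> residue n ` L" by (intro image_eqI)
next
  fix g h assume "g \<in> residue n ` L" "h \<in> residue n ` L"
  then obtain x y where x: "x \<in> L" "g = residue n x" and y: "y \<in> L" "h = residue n y" by blast
  have "x \<in> carrier_vec n" "y \<in> carrier_vec n" using x y L_carrier by blast+
  then have "g - h = residue n (x + of_int (-1) \<cdot>\<^sub>v y)"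
    by (auto simp: x y residue_def fun_eq_iff to_circle_diff)
  then show "g - h \<in> residue n ` L" using L_closed[OF x(1) y(1)] by blast
qed

text \<open>With a common denominator \<open>q\<close>, every entry of a residue is one of finitely
  many q-torsion points.\<close>

lemma finite_residues: "finite (residue n ` L)"
proof -
  obtain q where q: "q > (0::nat)" "\<forall>x\<in>L. \<forall>i<n. real q * x $ i \<in> \<int>" using denominator by blast
  let ?C = "(\<lambda>k. to_circle (real k / real q)) ` {..<q}"
  have "residue n ` L \<subseteq> {g. \<forall>i. (i \<in> {..<n} \<longrightarrow> g i \<in> ?C) \<and> (i \<notin> {..<n} \<longrightarrow> g i = 0)}"
  proof (intro image_subsetI CollectI allI conjI impI)
    fix x i assume x: "x \<in> L" and "i \<in> {..<n}"
    then have "cscale (int q) (residue n x i) = 0"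
      using q(2) by (simp add: residue_def cscale_to_circle to_circle_eq_0_iff)
    then show "residue n x i \<in> ?C" by (rule torsion_circle_subset[OF q(1)])
  qed (simp add: residue_def)
  then show ?thesis by (rule finite_subset) (intro finite_set_of_finite_funs; simp)
qed

text \<open>For the finite group \<open>G\<close> of residues, \<open>G[p]\<close> has as many elements as \<open>G/pG\<close>, which is
  generated by \<open>m\<close> elements of order \<open>p\<close>.\<close>

lemma card_torsion_residues_le:
  assumes "p > (0::nat)"
  shows "card {g \<in> residue n ` L. \<forall>i. cscale (int p) (g i) = 0} \<le> p ^ m"
proof -
  let ?G = "residue n ` L"
  define f :: "(nat \<Rightarrow> circle) \<Rightarrow> nat \<Rightarrow> circle" where "f g = (\<lambda>i. cscale (int p) (g i))" for g
  let ?D = "({..<m} \<rightarrow>\<^sub>E {..<p}) \<times> f ` ?G"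
  let ?F = "\<lambda>(r, h). residue n (gen_comb n gs (\<lambda>j. int (r j))) + h"
  have "g \<in> ?F ` ?D" if "g \<in> ?G" for g
  proof -
    obtain c where c: "g = residue n (gen_comb n gs c)" using \<open>g \<in> ?G\<close> residue_image by blast
    \<comment> \<open>Each coefficient is divided by \<open>p\<close>: the remainders give one of
      p^m combinations, and the quotients give an element of pG.\<close>
    define r where "r = (\<lambda>j\<in>{..<m}. nat (c j mod int p))"
    define d where "d j = c j div int p" for j
    have "gen_comb n gs c $ i = gen_comb n gs (\<lambda>j. int (r j)) $ i + of_int (int p) * gen_comb n gs d $ i"
      if "i < n" for i
    proof -
      have "real_of_int (c j) * y = of_int (int (r j)) * y + of_int (int p) * (of_int (d j) * y)"
        if "j < m" for j y
      proof -
        have "c j = int (r j) + int p * d j" using that assms by (simp add: r_def d_def)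
        then have "real_of_int (c j) = of_int (int (r j) + int p * d j)" by (rule arg_cong)
        then show ?thesis by (simp add: algebra_simps)
      qed
      then show ?thesis using that
        by (simp add: gen_comb_def length_gs sum_distrib_left flip: sum.distrib)
    qed
    then have "g = residue n (gen_comb n gs (\<lambda>j. int (r j))) + f (residue n (gen_comb n gs d))"
      by (auto simp: c f_def residue_def fun_eq_iff to_circle_add cscale_to_circle)
    moreover have "r \<in> {..<m} \<rightarrow>\<^sub>E {..<p}" using assms by (auto simp: r_def nat_less_iff)
    moreover have "f (residue n (gen_comb n gs d)) \<in> f ` ?G" using residue_image by blast
    ultimately show ?thesis by (intro image_eqI[of _ _ "(r, f (residue n (gen_comb n gs d)))"]) auto
  qed
  then have "?G \<subseteq> ?F ` ?D" by (rule subsetI)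
  moreover have finD: "finite ?D"
    using finite_residues by (intro finite_cartesian_product finite_PiE finite_imageI[of ?G f]) simp_all
  ultimately have "card ?G \<le> card (?F ` ?D)" by (intro card_mono finite_imageI[of ?D])
  also have "\<dots> \<le> card ?D" using finD by (rule card_image_le)
  also have "\<dots> = p ^ m * card (f ` ?G)" by (simp add: card_cartesian_product card_PiE)
  finally have "card ?G \<le> p ^ m * card (f ` ?G)" .
  moreover have "card ?G = card {g \<in> ?G. f g = 0} * card (f ` ?G)"
    using finite_residues residue_group
    by (intro card_kernel_times_image) (auto simp: f_def fun_eq_iff cscale_diff_right)
  moreover have "card (f ` ?G) > 0"
    using finite_residues add_subgroup_0[OF residue_group] by (auto simp: card_gt_0_iff)
  ultimately have "card {g \<in> ?G. f g = 0} \<le> p ^ m" by simp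
  then show ?thesis by (simp add: f_def fun_eq_iff)
qed

text \<open>A lift of norm at most 1 of a residue would itself be a point of \<open>L\<close> in the
  octahedron, hence 0 or plus or minus a unit vector, and all entries of these are integers.\<close>

lemma octahedral_code_residues:
  assumes adm: "octahedron_admissible n L"
  shows "octahedral_code n m (residue n ` L)"
proof
  show "finite (residue n ` L)" by (rule finite_residues)
  show "add_subgroup (residue n ` L)" by (rule residue_group)
  show "g i = 0" if "g \<in> residue n ` L" "n \<le> i" for g i
    using that by (auto simp: residue_def)
  show "card {g \<in> residue n ` L. \<forall>i. cscale (int p) (g i) = 0} \<le> p ^ m" if "prime p" for p
    using card_torsion_residues_le that prime_gt_0_nat by blast
  show "1 < (\<Sum>i<n. \<bar>x i\<bar>)" if mem: "(\<lambda>i. to_circle (x i)) \<in> residue n ` L" and j: "x j \<notin> \<int>"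
    for x :: "nat \<Rightarrow> real" and j
  proof (rule ccontr)
    assume neg: "\<not> ?thesis"
    obtain y where y: "y \<in> L" "(\<lambda>i. to_circle (x i)) = residue n y" using mem by blast
    obtain c where c: "\<forall>i<n. y $ i - gen_comb n gs c $ i \<in> \<int>" using y(1) unfolding L_iff by blast
    have jn: "j < n"
      using fun_cong[OF y(2), of j] j by (auto simp: residue_def to_circle_eq_0_iff split: if_splits)
    let ?v = "vec n x"
    have "x i - gen_comb n gs c $ i \<in> \<int>" if "i < n" for i
    proof -
      have "to_circle (x i - y $ i) = 0"
        using fun_cong[OF y(2), of i] that by (simp add: residue_def to_circle_diff)
      then have "(x i - y $ i) + (y $ i - gen_comb n gs c $ i) \<in> \<int>"
        using c that unfolding to_circle_eq_0_iff by (intro Ints_add) auto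
      then show ?thesis by simp
    qed
    then have "?v \<in> L" unfolding L_iff by auto
    moreover have "?v \<in> unit_octahedron n" using neg by (simp add: unit_octahedron_def)
    ultimately have "?v \<in> {0\<^sub>v n} \<union> set (unit_vecs n) \<union> uminus ` set (unit_vecs n)"
      using adm unfolding octahedron_admissible_def by blast
    then have "?v $ j \<in> \<int>"
    proof (elim UnE)
      assume "?v \<in> {0\<^sub>v n}"
      then have "?v = 0\<^sub>v n" by simp
      then show ?thesis using jn by (simp only: index_zero_vec) simp
    next
      assume "?v \<in> set (unit_vecs n)"
      then obtain k where "?v = unit_vec n k" by (auto simp: unit_vecs_def)
      then show ?thesis using jn by (simp only:) (simp add: unit_vec_def)
    next
      assume "?v \<in> uminus ` set (unit_vecs n)"
      then obtain k where "?v = - unit_vec n k" by (auto simp: unit_vecs_def)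
      then show ?thesis using jn by (simp only:) (simp add: unit_vec_def)
    qed
    then show False using j jn by simp
  qed
qed

text \<open>If \<open>x\<close> vanishes on \<open>T\<close>, then so does its residue; the residue
  is then 0, which means that \<open>x\<close> is integral.\<close>

lemma defect_le_of_injective:
  assumes T: "T \<subseteq> {..<n}" "\<forall>g\<in>residue n ` L. (\<forall>i\<in>T. g i = 0) \<longrightarrow> g = 0"
  shows "defect n L \<le> card T"
proof (rule defect_le[OF T(1)])
  fix x assume x: "x \<in> L" "\<forall>i\<in>T. x $ i = 0"
  then have "residue n x = 0" using T(2) by (auto simp: residue_def)
  then show "\<forall>i<n. x $ i \<in> \<int>"
    by (metis residue_def to_circle_eq_0_iff zero_fun_apply)
qed

end

section \<open>Existence of admissible lattices and the bound on the maximum\<close>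

text \<open>A nonzero integer entry has absolute value at least 1 and so uses up the whole
  norm.\<close>

lemma integral_octahedron:
  assumes x: "x \<in> carrier_vec n" "\<forall>i<n. x $ i \<in> \<int>" "(\<Sum>i<n. \<bar>x $ i :: real\<bar>) \<le> 1"
  shows "x \<in> {0\<^sub>v n} \<union> set (unit_vecs n) \<union> uminus ` set (unit_vecs n)"
proof (cases "x = 0\<^sub>v n")
  case False
  then obtain j where j: "j < n" "x $ j \<noteq> 0" using x(1) by (metis carrier_vecD eq_vecI index_zero_vec)
  have split: "(\<Sum>i<n. \<bar>x $ i\<bar>) = \<bar>x $ j\<bar> + (\<Sum>i\<in>{..<n} - {j}. \<bar>x $ i\<bar>)"
    using j by (intro sum.remove) auto
  have xj: "\<bar>x $ j\<bar> \<ge> 1" using x(2) j by (intro Ints_nonzero_abs_ge1) auto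
  have "(\<Sum>i\<in>{..<n} - {j}. \<bar>x $ i\<bar>) \<ge> 0" by (intro sum_nonneg) auto
  then have one: "\<bar>x $ j\<bar> = 1" and zero: "(\<Sum>i\<in>{..<n} - {j}. \<bar>x $ i\<bar>) = 0"
    using xj x(3) split by linarith+
  have "x $ i = 0" if "i < n" "i \<noteq> j" for i
    using zero that by (subst (asm) sum_nonneg_eq_0_iff) auto
  then have "x = unit_vec n j \<or> x = - unit_vec n j"
    using one x(1) j by (auto simp: abs_if unit_vec_def intro!: eq_vecI split: if_splits)
  then show ?thesis using j by (auto simp: unit_vecs_def)
qed simp

text \<open>The witness is Z^n, with \<open>m\<close> zero vectors as additional generators. It
  shows that the maximum defining \<open>max_defect\<close> is over a nonempty set.\<close>

lemma integral_lattice_admissible: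
  "\<exists>L\<in>lattice_class n m. octahedron_admissible n L"
proof -
  let ?gs = "replicate m (0\<^sub>v n) :: real vec list"
  let ?L = "int_span n (unit_vecs n @ ?gs)"
  have "gen_comb n ?gs c $ i = 0" if "i < n" for c i
    using that by (simp add: gen_comb_def)
  then have L: "?L = {x \<in> carrier_vec n. \<forall>i<n. x $ i \<in> \<int>}"
    by (subst int_span_unit_vecs_append) auto
  have "?L \<in> lattice_class n m"
    unfolding lattice_class_def by (intro CollectI exI[of _ ?gs]) (auto simp: rational_vecs_def)
  moreover have "octahedron_admissible n ?L"
    unfolding octahedron_admissible_def
  proof (intro subset_antisym subsetI)
    fix x assume "x \<in> unit_octahedron n \<inter> ?L"
    then show "x \<in> {0\<^sub>v n} \<union> set (unit_vecs n) \<union> uminus ` set (unit_vecs n)"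
      unfolding L unit_octahedron_def by (intro integral_octahedron) auto
  next
    fix x :: "real vec" assume x: "x \<in> {0\<^sub>v n} \<union> set (unit_vecs n) \<union> uminus ` set (unit_vecs n)"
    consider "x = 0\<^sub>v n" | j where "j < n" "x = unit_vec n j" | j where "j < n" "x = - unit_vec n j"
      using x by (auto simp: unit_vecs_def)
    then have "x \<in> carrier_vec n \<and> (\<forall>i<n. x $ i \<in> \<int>) \<and> (\<Sum>i<n. \<bar>x $ i\<bar>) \<le> 1"
    proof cases
      case 1
      then show ?thesis by simp
    next
      case (2 j)
      have "(\<Sum>i<n. \<bar>x $ i\<bar>) = (\<Sum>i<n. if i = j then 1 else 0)"
        using 2 by (intro sum.cong) auto
      then show ?thesis using 2 by simp
    next
      case (3 j)
      have "(\<Sum>i<n. \<bar>x $ i\<bar>) = (\<Sum>i<n. if i = j then 1 else 0)"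
        using 3 by (intro sum.cong) auto
      then show ?thesis using 3 by simp
    qed
    then show "x \<in> unit_octahedron n \<inter> ?L"
      unfolding L unit_octahedron_def by simp
  qed
  ultimately show ?thesis by blast
qed

lemma defect_le_bound:
  assumes m: "0 < m" "m + 1 < n" and L: "L \<in> lattice_class n m" "octahedron_admissible n L"
  shows "real (defect n L) \<le> max (4 / (ln (ln 3))\<^sup>2) (60 / ln 2) *
    (real n * ln (real m + 1) / ln (real n / real m)) * (ln (ln ((real n / real m) ^ m)))\<^sup>2"
proof -
  obtain gs where "L = int_span n (unit_vecs n @ gs)" "length gs = m" "set gs \<subseteq> rational_vecs n"
    using L(1) by (auto simp: lattice_class_def)
  then interpret rational_lattice n m L gs by unfold_locales
  interpret code: octahedral_code n m "residue n ` L"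
    by (rule octahedral_code_residues[OF L(2)])
  show ?thesis
  proof (rule optimize_parameters[OF m])
    show "real (defect n L) \<le> real n" using defect_le_dim by simp
    fix P t :: nat and w :: real
    assume P: "P > 1" and w: "w > 0" "w * ln (real m * w) \<le> ln (real P)"
    have n: "n > 0" using m by simp
    obtain T where T: "T \<subseteq> {..<n}" "\<forall>g\<in>residue n ` L. (\<forall>i\<in>T. g i = 0) \<longrightarrow> g = 0"
      "real (card T) \<le> t + m * P + exp (- (real t * w / n)) * (m * (n * ln n / ln (real P)))"
      using code.injective_coordinates[OF P n w, of t] by (elim exE conjE)
    have "real (defect n L) \<le> real (card T)" using defect_le_of_injective[OF T(1,2)] by simp
    then show "real (defect n L) \<le> t + m * P + exp (- (real t * w / n)) * (m * (n * ln n / ln (real P)))"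
      using T(3) by (rule order_trans)
  qed
qed

theorem theorem1:
  shows "\<exists>C::real. C > 0 \<and>
    (\<forall>m n :: nat. 0 < m \<and> m + 1 < n \<longrightarrow>
      real (max_defect n m) \<le>
        C * (real n * ln (real m + 1) / ln (real n / real m)) *
        (ln (ln ((real n / real m) ^ m)))\<^sup>2)"
proof (intro exI[of _ "max (4 / (ln (ln 3))\<^sup>2) (60 / ln 2) :: real"] conjI allI impI)
  show "0 < max (4 / (ln (ln 3))\<^sup>2) (60 / ln 2 :: real)" by (simp add: less_max_iff_disj)
  fix m n :: nat assume mn: "0 < m \<and> m + 1 < n"
  let ?S = "{L \<in> lattice_class n m. octahedron_admissible n L}"
  have le: "defect n L \<le> n" if L: "L \<in> lattice_class n m" for L
  proof -
    obtain gs where "L = int_span n (unit_vecs n @ gs)" "length gs = m" "set gs \<subseteq> rational_vecs n"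
      using L by (auto simp: lattice_class_def)
    then interpret rational_lattice n m L gs by unfold_locales
    show ?thesis by (rule defect_le_dim)
  qed
  \<comment> \<open>\<open>Max\<close> is attained because all defects are at most \<open>n\<close>
    and some admissible lattice exists.\<close>
  have "finite (defect n ` ?S)" by (rule finite_subset[OF _ finite_atMost[of n]]) (use le in auto)
  moreover have "defect n ` ?S \<noteq> {}" using integral_lattice_admissible by auto
  ultimately have "max_defect n m \<in> defect n ` ?S" unfolding max_defect_def by (rule Max_in)
  then obtain L where L: "L \<in> lattice_class n m" "octahedron_admissible n L" "max_defect n m = defect n L"
    by auto
  from mn have "0 < m" "m + 1 < n" by simp_all
  from defect_le_bound[OF this L(1,2)] show "real (max_defect n m) \<le> max (4 / (ln (ln 3))\<^sup>2) (60 / ln 2) *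
      (real n * ln (real m + 1) / ln (real n / real m)) * (ln (ln ((real n / real m) ^ m)))\<^sup>2"
    by (simp only: L(3))
qed

end
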